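(* Let $\mu$ be a probability distribution on $\mathbb{R}^{n\times n}$ with bounded support, let $A$ be a random matrix with distribution $\mu$, and let $p$ be a positive integer. Assume that $\Sigma_\mu$ is $p$th mean stable and that $p$ is even. Let $q:=p/2$ and let $\gamma\in(\rho_{p,\mu},1)$ be arbitrary. Then the function $$V(x)=(x^{\otimes q})^\top Hx^{\otimes q},\qquad x\in\mathbb{R}^n,$$ where the positive definite matrix $H\in\mathbb{R}^{n^q\times n^q}$ is a solution of the linear matrix inequality $$E[(A^{\otimes q})^\top HA^{\otimes q}]-\gamma^pH\preceq 0,$$ is a stochastic Lyapunov function for $\Sigma_\mu$ of degree $p$ with growth rate $\gamma$.
   Context: $\Sigma_\mu$ is the stochastic switched linear system $x(k+1)=A_kx(k)$ where the $A_k$ are independent random matrices with distribution $\mu$ and $x(0)=x_0\in\mathbb{R}^n$ is constant. It is $p$th mean stable if there exist $C>0$ and $\gamma\in[0,1)$ such that $E[\|x(k)\|^p]\le C\gamma^{pk}\|x_0\|^p$ for every $k\ge 0$ and every $x_0\in\mathbb{R}^n$. A function $V\colon\mathbb{R}^n\to\mathbb{R}$ is a stochastic Lyapunov function of degree $p$ for $\Sigma_\mu$ with growth rate $\gamma\in[0,1)$ if there exist positive numbers $C_1,C_2$ such that, for every $x\in\mathbb{R}^n$, $C_1\|x\|^p\le V(x)\le C_2\|x\|^p$ and $E[V(Ax)]\le\gamma^pV(x)$, where $A$ has distribution $\mu$. The $p$-radius of $\mu$ is $\rho_{p,\mu}=\lim_{k\to\infty}(E[\|A_k\cdots A_1\|^p])^{1/(pk)}$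 with $A_1,A_2,\dots$ independent with distribution $\mu$ (the limit exists and is finite for $\mu$ of bounded support). Norms are Euclidean on vectors and maximal singular value on matrices. $X^{\otimes q}$ is the $q$-fold Kronecker power of a matrix or column vector $X$: $X^{\otimes1}=X$, $X^{\otimes q}=X^{\otimes(q-1)}\otimes X$. $B\preceq0$ means that $B$ is symmetric and negative semidefinite. *)

theory Defs
  imports "HOL-Probability.Probability" "Jordan_Normal_Form.Matrix"
begin

text \<open>
  A distribution on the n by n matrices is a Borel probability measure on
  \<^typ>\<open>real^'n^'n\<close>, with n the cardinality of the index type. The matrix H and the Kronecker
  powers have size n^q, where q is a variable of the statement, so they are matrices of the type
  \<^typ>\<open>real mat\<close>, whose size is a number.
\<close>

section \<open>Stochastic switched linear systems\<close>

definition matrix_distribution :: "(real^'n^'n) measure \<Rightarrow> bool" where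
  "matrix_distribution \<mu> \<longleftrightarrow> prob_space \<mu> \<and> sets \<mu> = sets borel"

definition msupport :: "'a::topological_space measure \<Rightarrow> 'a set" where
  "msupport \<mu> = {x. \<forall>U. open U \<and> x \<in> U \<longrightarrow> emeasure \<mu> U > 0}"

text \<open>
  The independent sequence with distribution \<open>\<mu>\<close> is realized by the coordinate maps on the
  countable product of copies of \<open>\<mu>\<close>. The notions below depend only on the joint law of the
  sequence, so the choice of realization does not matter.
\<close>

definition iid_space :: "(real^'n^'n) measure \<Rightarrow> (nat \<Rightarrow> real^'n^'n) measure" where
  "iid_space \<mu> = PiM UNIV (\<lambda>_. \<mu>)"

primrec switched_state :: "(nat \<Rightarrow> real^'n^'n) \<Rightarrow> real^'n \<Rightarrow> nat \<Rightarrow> real^'n" where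
  "switched_state A x\<^sub>0 0 = x\<^sub>0"
| "switched_state A x\<^sub>0 (Suc k) = A k *v switched_state A x\<^sub>0 k"

text \<open>
  The Bochner integral of a function that is not integrable is 0, hence the integrability
  conditions in the next definition and in that of a Lyapunov function.
\<close>

definition mean_stable :: "nat \<Rightarrow> (real^'n^'n) measure \<Rightarrow> bool" where
  "mean_stable p \<mu> \<longleftrightarrow>
    (\<exists>C \<gamma>. C > 0 \<and> 0 \<le> \<gamma> \<and> \<gamma> < 1 \<and>
      (\<forall>k x\<^sub>0. integrable (iid_space \<mu>) (\<lambda>A. norm (switched_state A x\<^sub>0 k) ^ p) \<and>
        (\<integral>A. norm (switched_state A x\<^sub>0 k) ^ p \<partial>iid_space \<mu>) \<le> C * \<gamma> ^ (p * k) * norm x\<^sub>0 ^ p))"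

definition stochastic_lyapunov ::
    "(real^'n^'n) measure \<Rightarrow> nat \<Rightarrow> real \<Rightarrow> (real^'n \<Rightarrow> real) \<Rightarrow> bool" where
  "stochastic_lyapunov \<mu> p \<gamma> V \<longleftrightarrow> 0 \<le> \<gamma> \<and> \<gamma> < 1 \<and>
    (\<exists>C\<^sub>1 C\<^sub>2. C\<^sub>1 > 0 \<and> C\<^sub>2 > 0 \<and>
      (\<forall>x. C\<^sub>1 * norm x ^ p \<le> V x \<and> V x \<le> C\<^sub>2 * norm x ^ p \<and>
        integrable \<mu> (\<lambda>A. V (A *v x)) \<and>
        (\<integral>A. V (A *v x) \<partial>\<mu>) \<le> \<gamma> ^ p * V x))"

section \<open>The p-radius\<close>

definition singular_values :: "real^'n^'m \<Rightarrow> real set" where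
  "singular_values A =
    {s. s \<ge> 0 \<and> (\<exists>v. v \<noteq> 0 \<and> (transpose A ** A) *v v = s\<^sup>2 *\<^sub>R v)}"

definition spectral_norm :: "real^'n^'m \<Rightarrow> real" where
  "spectral_norm A = Max (singular_values A)"

text \<open>\<open>left_product A k\<close> is \<open>A k ** \<dots> ** A 1\<close>; the coordinate \<open>A 0\<close> is not used.\<close>

primrec left_product :: "(nat \<Rightarrow> real^'n^'n) \<Rightarrow> nat \<Rightarrow> real^'n^'n" where
  "left_product A 0 = Finite_Cartesian_Product.mat 1"
| "left_product A (Suc k) = A (Suc k) ** left_product A k"

definition p_radius :: "nat \<Rightarrow> (real^'n^'n) measure \<Rightarrow> real" where
  "p_radius p \<mu> =
    lim (\<lambda>k. (\<integral>A. spectral_norm (left_product A k) ^ p \<partial>iid_space \<mu>) powr (1 / real (p * k)))"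

section \<open>Kronecker powers\<close>

definition kronecker :: "real mat \<Rightarrow> real mat \<Rightarrow> real mat" (infixl \<open>\<otimes>\<^sub>K\<close> 75) where
  "X \<otimes>\<^sub>K Y = Matrix.mat (dim_row X * dim_row Y) (dim_col X * dim_col Y)
    (\<lambda>(i, j). X $$ (i div dim_row Y, j div dim_col Y) * Y $$ (i mod dim_row Y, j mod dim_col Y))"

primrec kronecker_power :: "real mat \<Rightarrow> nat \<Rightarrow> real mat" where
  "kronecker_power X 0 = 1\<^sub>m 1"
| "kronecker_power X (Suc q) = kronecker_power X q \<otimes>\<^sub>K X"

lemma kronecker_power_1: "kronecker_power X 1 = X"
  by (rule eq_matI) (auto simp: kronecker_def)

text \<open>
  The rows and columns are numbered by the library's enumeration of the finite index type, a
  bijection from \<open>{..<CARD('n)}\<close> to \<open>UNIV\<close>. A column vector becomes a matrix with one column.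
\<close>

abbreviation enum_index :: "nat \<Rightarrow> 'n::finite" where
  "enum_index \<equiv> from_nat_into UNIV"

definition numbered_mat :: "real^'n^'n \<Rightarrow> real mat" where
  "numbered_mat A =
    Matrix.mat CARD('n) CARD('n) (\<lambda>(i, j). vec_nth (vec_nth A (enum_index i)) (enum_index j))"

definition numbered_col :: "real^'n \<Rightarrow> real mat" where
  "numbered_col x = Matrix.mat CARD('n) 1 (\<lambda>(i, _). vec_nth x (enum_index i))"

section \<open>Definiteness and expectation of matrices\<close>

definition positive_definite :: "nat \<Rightarrow> real mat \<Rightarrow> bool" where
  "positive_definite d B \<longleftrightarrow> B \<in> carrier_mat d d \<and> transpose_mat B = B \<and>
    (\<forall>v \<in> carrier_vec d. v \<noteq> 0\<^sub>v d \<longrightarrow> scalar_prod v (B *\<^sub>v v) > 0)"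

definition negative_semidefinite :: "nat \<Rightarrow> real mat \<Rightarrow> bool" where
  "negative_semidefinite d B \<longleftrightarrow> B \<in> carrier_mat d d \<and> transpose_mat B = B \<and>
    (\<forall>v \<in> carrier_vec d. scalar_prod v (B *\<^sub>v v) \<le> 0)"

definition expectation_mat :: "nat \<Rightarrow> 'w measure \<Rightarrow> ('w \<Rightarrow> real mat) \<Rightarrow> real mat" where
  "expectation_mat d M F = Matrix.mat d d (\<lambda>ij. \<integral>\<omega>. F \<omega> $$ ij \<partial>M)"

definition lmi_solution :: "(real^'n^'n) measure \<Rightarrow> nat \<Rightarrow> nat \<Rightarrow> real \<Rightarrow> real mat \<Rightarrow> bool" where
  "lmi_solution \<mu> p q \<gamma> H \<longleftrightarrow>
    negative_semidefinite (CARD('n) ^ q)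
      (expectation_mat (CARD('n) ^ q) \<mu>
         (\<lambda>A. transpose_mat (kronecker_power (numbered_mat A) q) * H
                * kronecker_power (numbered_mat A) q)
       - \<gamma> ^ p \<cdot>\<^sub>m H)"

definition kronecker_form :: "nat \<Rightarrow> real mat \<Rightarrow> real^'n \<Rightarrow> real" where
  "kronecker_form q H x =
    (transpose_mat (kronecker_power (numbered_col x) q) * H
       * kronecker_power (numbered_col x) q) $$ (0, 0)"

end

theory Submission
  imports Defs
begin

text \<open>
  Write \<open>K A\<close> for the \<open>q\<close>-fold Kronecker power of \<open>A\<close> and \<open>\<Phi>\<^sub>k\<close> for the product of \<open>k\<close> independent
  random matrices. The moments \<open>E (norm \<Phi>\<^sub>k ^ p)\<close> are submultiplicative by independence, so Fekete's
  lemma gives the limit defining the \<open>p\<close>-radius, and the moments are \<open>o(\<gamma> ^ (p * k))\<close> for every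
  larger \<open>\<gamma>\<close>. With the Gram matrices \<open>G\<^sub>k = E ((K \<Phi>\<^sub>k)\<^sup>T (K \<Phi>\<^sub>k))\<close>, a solution of the matrix
  inequality is the truncated series \<open>H = (\<Sum>k<m. \<gamma> ^ (- p * k) G\<^sub>k)\<close>: by independence
  \<open>E ((K A)\<^sup>T G\<^sub>k (K A)) = G\<^sub>k\<^sub>+\<^sub>1\<close>, so the left side telescopes to
  \<open>\<gamma> ^ p (\<gamma> ^ (- p * m) G\<^sub>m - 1)\<close>, which is negative for large \<open>m\<close>.

  Conversely, a positive definite \<open>H\<close> makes \<open>V\<close> continuous, homogeneous of degree \<open>p\<close> and positive
  on the unit sphere, whence the two norm bounds by compactness. The growth bound is the matrix
  inequality evaluated at the Kronecker power of \<open>x\<close>, because the Kronecker power is multiplicative.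
\<close>

section \<open>The spectral norm\<close>

lemma norm_matrix_vector_mult_le: "norm (A *v x) \<le> onorm ((*v) A) * norm x"
  for A :: "real^'n^'m"
  by (intro onorm matrix_vector_mul_bounded_linear)

lemma inner_transpose_mult: "inner x ((transpose A ** A) *v y) = inner (A *v x) (A *v y)"
  for A :: "real^'n^'m"
proof -
  have "inner x ((transpose A ** A) *v y) = inner x (transpose A *v (A *v y))"
    by (simp add: matrix_vector_mul_assoc)
  also have "\<dots> = inner (x v* transpose A) (A *v y)"
    by (rule dot_lmul_matrix[symmetric])
  also have "x v* transpose A = A *v x"
    by simp
  finally show ?thesis .
qed

text \<open>For an eigenvector \<open>v\<close> of the Gram matrix with eigenvalue
  \<open>s\<^sup>2\<close>, the identity \<open>inner_transpose_mult\<close> gives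
  \<open>norm (A *v v) = s * norm v\<close>.\<close>

lemma singular_value_le_onorm:
  fixes A :: "real^'n^'m"
  assumes "s \<in> singular_values A"
  shows "s \<le> onorm ((*v) A)"
proof -
  obtain v where v: "s \<ge> 0" "v \<noteq> 0" "(transpose A ** A) *v v = s\<^sup>2 *\<^sub>R v"
    using assms by (auto simp: singular_values_def)
  have "(norm (A *v v))\<^sup>2 = (s * norm v)\<^sup>2"
    using inner_transpose_mult[of v A v] v
    by (simp add: power_mult_distrib dot_square_norm)
  then have "s * norm v = norm (A *v v)"
    using v by simp
  also have "\<dots> \<le> onorm ((*v) A) * norm v"
    by (rule norm_matrix_vector_mult_le)
  finally show ?thesis
    using v by simp
qed

text \<open>Eigenvectors of the symmetric Gram matrix for distinct eigenvalues are orthogonal, so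
  one choice per singular value gives an independent set, finite in finite dimension. This makes the
  \<open>Max\<close> in \<open>spectral_norm\<close> meaningful.\<close>

lemma finite_singular_values: "finite (singular_values A)"
  for A :: "real^'n^'m"
proof -
  define e where "e s = (SOME v. v \<noteq> 0 \<and> (transpose A ** A) *v v = s\<^sup>2 *\<^sub>R v)" for s
  have e: "e s \<noteq> 0 \<and> (transpose A ** A) *v (e s) = s\<^sup>2 *\<^sub>R e s" "s \<ge> 0"
    if "s \<in> singular_values A" for s
  proof -
    have ex: "\<exists>v. v \<noteq> 0 \<and> (transpose A ** A) *v v = s\<^sup>2 *\<^sub>R v" and "s \<ge> 0"
      using that by (auto simp: singular_values_def)
    then show "e s \<noteq> 0 \<and> (transpose A ** A) *v (e s) = s\<^sup>2 *\<^sub>R e s" "s \<ge> 0"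
      unfolding e_def using someI_ex[OF ex] by blast+
  qed
  have orth: "inner (e s) (e t) = 0"
    if "s \<in> singular_values A" "t \<in> singular_values A" "s \<noteq> t" for s t
  proof -
    have "t\<^sup>2 * inner (e s) (e t) = s\<^sup>2 * inner (e t) (e s)"
      using inner_transpose_mult[of "e s" A "e t"] inner_transpose_mult[of "e t" A "e s"] e that
      by (simp add: inner_commute)
    then have "(t\<^sup>2 - s\<^sup>2) * inner (e s) (e t) = 0"
      by (simp add: inner_commute algebra_simps)
    moreover have "t\<^sup>2 \<noteq> s\<^sup>2"
      using e(2) that by (simp add: power2_eq_iff_nonneg)
    ultimately show ?thesis by simp
  qed
  have inj: "inj_on e (singular_values A)"
  proof (rule inj_onI, rule ccontr)
    fix s t assume "s \<in> singular_values A" "t \<in> singular_values A" "e s = e t" "s \<noteq> t"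
    then show False
      using orth[of s t] e(1)[of s] by simp
  qed
  have "independent (e ` singular_values A)"
    by (intro pairwise_orthogonal_independent)
      (auto simp: pairwise_def real_inner_class.orthogonal_def intro: orth dest: e(1))
  then have "finite (e ` singular_values A)"
    by (rule independent_imp_finite)
  then show ?thesis
    by (rule finite_imageD[OF _ inj])
qed

text \<open>First-order condition at the minimum \<open>t = 0\<close>: for small \<open>t\<close>
  the linear term dominates, so a nonzero \<open>b\<close> would produce a negative value.\<close>

lemma quadratic_form_zero_imp_bilinear_zero:
  fixes a b :: real
  assumes "\<And>t. 0 \<le> 2 * t * b + t\<^sup>2 * a"
  shows "b = 0"
proof (rule ccontr)
  assume "b \<noteq> 0"
  \<comment> \<open>Any positive \<open>u\<close> with \<open>a < 2 * u\<close> works: at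
    \<open>t = - b / u\<close> the expression equals
    \<open>b\<^sup>2 * (a - 2 * u) / u\<^sup>2\<close>.\<close>
  define u where "u = \<bar>a\<bar> + 1"
  define t where "t = - b / u"
  have "u > 0" "a < 2 * u"
    by (auto simp: u_def)
  then have tu: "t * u = - b"
    by (simp add: t_def)
  have "(2 * t * b + t\<^sup>2 * a) * u\<^sup>2 = 2 * (t * u) * b * u + (t * u)\<^sup>2 * a"
    by (simp add: power2_eq_square algebra_simps)
  also have "\<dots> = b\<^sup>2 * (a - 2 * u)"
    unfolding tu by (simp add: power2_eq_square algebra_simps)
  also have "\<dots> < 0"
    using \<open>b \<noteq> 0\<close> \<open>a < 2 * u\<close> by (simp add: mult_pos_neg)
  finally have "2 * t * b + t\<^sup>2 * a < 0"
    using \<open>u > 0\<close> by (simp add: mult_less_0_iff)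
  then show False
    using assms[of t] by simp
qed

text \<open>A maximizer of \<open>norm (A *v x)\<close> on the unit sphere is an eigenvector of the Gram matrix.\<close>

lemma onorm_in_singular_values: "onorm ((*v) A) \<in> singular_values A"
  for A :: "real^'n^'m"
proof -
  have "compact (sphere (0 :: real^'n) 1)" "sphere (0 :: real^'n) 1 \<noteq> {}"
    by simp_all
  moreover have "continuous_on (sphere 0 1) (\<lambda>x. norm (A *v x))"
    by (intro continuous_intros linear_continuous_on matrix_vector_mul_bounded_linear)
  ultimately obtain v where v: "norm v = 1"
    and vmax: "\<And>x. norm x = 1 \<Longrightarrow> norm (A *v x) \<le> norm (A *v v)"
    using continuous_attains_sup[of "sphere 0 1" "\<lambda>x. norm (A *v x)"] by auto
  define s where "s = norm (A *v v)"
  have le: "norm (A *v x) \<le> s * norm x" for x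
  proof (cases "x = 0")
    case False
    have "norm (A *v ((1 / norm x) *\<^sub>R x)) \<le> s"
      unfolding s_def using False by (intro vmax) simp
    also have "A *v ((1 / norm x) *\<^sub>R x) = (1 / norm x) *\<^sub>R (A *v x)"
      by (rule linear_scale) simp
    finally show ?thesis
      using False by (simp add: field_simps)
  qed simp
  have "onorm ((*v) A) = s"
  proof (rule antisym)
    show "onorm ((*v) A) \<le> s"
      by (rule onorm_bound[OF _ le]) (simp add: s_def)
    show "s \<le> onorm ((*v) A)"
      using norm_matrix_vector_mult_le[of A v] v by (simp add: s_def)
  qed
  moreover have "(transpose A ** A) *v v = s\<^sup>2 *\<^sub>R v"
  proof -
    \<comment> \<open>The function
      \<open>s\<^sup>2 * (norm x)\<^sup>2 - (norm (A *v x))\<^sup>2\<close> is nonnegative and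
      vanishes at \<open>v\<close>; along the line \<open>v + t *\<^sub>R y\<close> it is a
      quadratic polynomial in \<open>t\<close> without constant term.\<close>
    have "inner y (s\<^sup>2 *\<^sub>R v - (transpose A ** A) *v v) = 0" for y
    proof (rule quadratic_form_zero_imp_bilinear_zero)
      fix t :: real
      have "(norm (A *v (v + t *\<^sub>R y)))\<^sup>2 \<le> (s * norm (v + t *\<^sub>R y))\<^sup>2"
        by (intro power_mono le) simp
      then have "inner (A *v (v + t *\<^sub>R y)) (A *v (v + t *\<^sub>R y))
          \<le> s\<^sup>2 * inner (v + t *\<^sub>R y) (v + t *\<^sub>R y)"
        by (simp add: power_mult_distrib power2_norm_eq_inner)
      moreover have "A *v (v + t *\<^sub>R y) = A *v v + t *\<^sub>R (A *v y)"
        by (simp add: matrix_vector_right_distrib linear_scale)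
      moreover have "inner y ((transpose A ** A) *v v) = inner (A *v y) (A *v v)"
        by (rule inner_transpose_mult)
      moreover have "inner v v = 1" "inner (A *v v) (A *v v) = s\<^sup>2"
        using v by (simp_all add: dot_square_norm s_def)
      ultimately show "0 \<le> 2 * t * inner y (s\<^sup>2 *\<^sub>R v - (transpose A ** A) *v v)
          + t\<^sup>2 * (s\<^sup>2 * inner y y - inner (A *v y) (A *v y))"
        by (simp add: inner_add_left inner_add_right
            inner_diff_right algebra_simps power2_eq_square inner_commute)
    qed
    from this[of "s\<^sup>2 *\<^sub>R v - (transpose A ** A) *v v"] show ?thesis
      by simp
  qed
  ultimately show ?thesis
    using v by (auto simp: singular_values_def s_def intro!: exI[of _ v])
qed

text \<open>The operator norm bounds all singular values and is one itself. Submultiplicativity and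
  continuity are then inherited from it.\<close>

lemma spectral_norm_eq_onorm: "spectral_norm A = onorm ((*v) A)"
  for A :: "real^'n^'m"
  unfolding spectral_norm_def
  by (intro Max_eqI finite_singular_values singular_value_le_onorm onorm_in_singular_values)

lemma spectral_norm_nonneg: "0 \<le> spectral_norm A"
  for A :: "real^'n^'m"
  by (simp add: spectral_norm_eq_onorm onorm_pos_le)

lemma spectral_norm_mult_le: "spectral_norm (A ** B) \<le> spectral_norm A * spectral_norm B"
  for A :: "real^'n^'m" and B :: "real^'k^'n"
proof -
  have "(*v) (A ** B) = (*v) A \<circ> (*v) B"
    by (auto simp: matrix_vector_mul_assoc)
  then show ?thesis
    by (simp add: spectral_norm_eq_onorm onorm_compose)
qed

lemma abs_component_le_spectral_norm: "\<bar>vec_nth (vec_nth A i) j\<bar> \<le> spectral_norm A"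
  for A :: "real^'n^'m"
  by (simp add: spectral_norm_eq_onorm matrix_component_le_onorm)

text \<open>Sending a matrix to its bounded linear operator is linear on a finite-dimensional space,
  hence continuous, and the norm of that operator is the spectral norm.\<close>

lemma continuous_on_spectral_norm: "continuous_on UNIV (spectral_norm :: real^'n^'m \<Rightarrow> real)"
proof -
  have "bounded_linear (\<lambda>A :: real^'n^'m. Blinfun ((*v) A))"
  proof (rule linear_conv_bounded_linear[THEN iffD1], rule linearI)
    fix A B :: "real^'n^'m" and c :: real
    show "Blinfun ((*v) (A + B)) = Blinfun ((*v) A) + Blinfun ((*v) B)"
      by (rule blinfun_eqI)
        (simp add: bounded_linear_Blinfun_apply blinfun.add_left matrix_vector_mult_add_rdistrib)
    show "Blinfun ((*v) (c *\<^sub>R A)) = c *\<^sub>R Blinfun ((*v) A)"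
      by (rule blinfun_eqI)
        (simp add: bounded_linear_Blinfun_apply blinfun.scaleR_left scaleR_matrix_vector_assoc)
  qed
  then have "continuous_on UNIV (\<lambda>A :: real^'n^'m. norm (Blinfun ((*v) A)))"
    by (intro continuous_intros linear_continuous_on)
  moreover have "norm (Blinfun ((*v) A)) = spectral_norm A" for A :: "real^'n^'m"
    by (simp add: norm_blinfun.rep_eq bounded_linear_Blinfun_apply spectral_norm_eq_onorm)
  ultimately show ?thesis by simp
qed

section \<open>Submultiplicative sequences\<close>

lemma submultiplicative_power_le:
  fixes a :: "nat \<Rightarrow> real"
  assumes nonneg: "\<And>k. 0 \<le> a k" and sub: "\<And>m k. a (m + k) \<le> a m * a k"
  shows "a (j * m + r) \<le> a m ^ j * a r"
proof (induction j)
  case (Suc j)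
  have "a (Suc j * m + r) \<le> a m * a (j * m + r)"
    using sub[of m "j * m + r"] by (simp add: algebra_simps)
  also have "\<dots> \<le> a m * (a m ^ j * a r)"
    by (intro mult_left_mono Suc nonneg)
  finally show ?case by (simp add: mult_ac)
qed simp

text \<open>One index \<open>m\<close> with \<open>a m \<le> s ^ m\<close> controls everything:
  writing \<open>k = j * m + r\<close> with \<open>r < m\<close>, the full blocks contribute
  \<open>s ^ (j * m)\<close> and the finitely many remainders go into \<open>C\<close>.\<close>

lemma submultiplicative_geometric_bound:
  fixes a :: "nat \<Rightarrow> real"
  assumes nonneg: "\<And>k. 0 \<le> a k" and sub: "\<And>m k. a (m + k) \<le> a m * a k"
    and inf: "(INF k\<in>{1..}. a k powr (1 / real k)) < s"
  obtains C where "C > 0" "\<And>k. a k \<le> C * s ^ k"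
proof -
  obtain m where m: "m \<ge> 1" "a m powr (1 / real m) < s"
    using inf by (subst (asm) cInf_less_iff) (auto intro!: bdd_belowI[of _ 0])
  then have s: "s > 0"
    by (meson order_le_less_trans powr_ge_zero)
  have "a m \<le> s ^ m"
  proof -
    \<comment> \<open>If \<open>a m = 0\<close>, then \<open>powr\<close> has value 0 at base 0, and
      \<open>m \<ge> 1\<close> makes the power 0 as well.\<close>
    have "a m = (a m powr (1 / real m)) ^ m"
      using m(1) nonneg[of m]
      by (cases "a m = 0") (simp_all add: powr_powr flip: powr_realpow)
    also have "\<dots> \<le> s ^ m"
      using m(2) by (intro power_mono) auto
    finally show ?thesis .
  qed
  \<comment> \<open>The sum dominates each \<open>a r / s ^ r\<close>; the added 1 keeps
    \<open>C\<close> positive even if all of them vanish.\<close>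
  define C where "C = 1 + (\<Sum>r<m. a r / s ^ r)"
  have "C > 0"
    unfolding C_def using s by (intro add_pos_nonneg sum_nonneg) (simp_all add: nonneg)
  moreover have "a k \<le> C * s ^ k" for k
  proof -
    define r where "r = k mod m"
    have r: "r < m"
      using m by (simp add: r_def)
    have k: "k = (k div m) * m + r"
      by (simp add: r_def)
    have "a k \<le> a m ^ (k div m) * a r"
      using submultiplicative_power_le[where a = a, OF nonneg sub, of "k div m" m r] k by simp
    also have "\<dots> \<le> (s ^ m) ^ (k div m) * (C * s ^ r)"
    proof (intro mult_mono power_mono \<open>a m \<le> s ^ m\<close>)
      have "a r / s ^ r \<le> (\<Sum>r<m. a r / s ^ r)"
        using r s nonneg by (intro member_le_sum) auto
      also have "\<dots> \<le> C" by (simp add: C_def)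
      finally show "a r \<le> C * s ^ r"
        using s by (simp add: divide_le_eq)
    qed (use s nonneg in auto)
    also have "\<dots> = C * s ^ ((k div m) * m + r)"
      by (simp add: power_add power_mult[symmetric] mult_ac)
    also have "\<dots> = C * s ^ k"
      using k by simp
    finally show ?thesis .
  qed
  ultimately show ?thesis using that by blast
qed

text \<open>Fekete's lemma in multiplicative form.\<close>

lemma submultiplicative_root_tendsto:
  fixes a :: "nat \<Rightarrow> real"
  assumes nonneg: "\<And>k. 0 \<le> a k" and sub: "\<And>m k. a (m + k) \<le> a m * a k"
  shows "(\<lambda>k. a k powr (1 / real k)) \<longlonglongrightarrow> (INF k\<in>{1..}. a k powr (1 / real k))"
    (is "_ \<longlonglongrightarrow> ?L")
proof (rule order_tendstoI)
  \<comment> \<open>The index 0 stays outside the infimum: since \<open>1 / real 0 = 0\<close>, its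
    term would be 0 or 1 whatever the growth of \<open>a\<close>.\<close>
  have L: "?L \<le> a k powr (1 / real k)" if "k \<ge> 1" for k
    using that by (intro cINF_lower) (auto intro!: bdd_belowI[of _ 0])
  fix b
  show "\<forall>\<^sub>F k in sequentially. b < a k powr (1 / real k)" if "b < ?L"
    using eventually_ge_at_top[of 1]
    by eventually_elim (use that L in force)
  show "\<forall>\<^sub>F k in sequentially. a k powr (1 / real k) < b" if "?L < b"
  proof -
    obtain s where s: "?L < s" "s < b"
      using \<open>?L < b\<close> dense by blast
    have "0 \<le> ?L"
      by (intro cINF_greatest) auto
    then have "s > 0" using s by simp
    obtain C where C: "C > 0" "\<And>k. a k \<le> C * s ^ k"
      using submultiplicative_geometric_bound[where a = a, OF nonneg sub s(1)] by blast
    \<comment> \<open>The constant disappears in the limit, because its \<open>k\<close>th root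
      tends to \<open>C powr 0 = 1\<close>.\<close>
    have "(\<lambda>k. C powr (1 / real k) * s) \<longlonglongrightarrow> C powr 0 * s"
      using C(1) by (intro tendsto_intros lim_1_over_n) auto
    then have "(\<lambda>k. C powr (1 / real k) * s) \<longlonglongrightarrow> s"
      using C(1) by simp
    then have "\<forall>\<^sub>F k in sequentially. C powr (1 / real k) * s < b"
      using s(2) by (rule order_tendstoD)
    then show ?thesis
      using eventually_ge_at_top[of 1]
    proof eventually_elim
      case (elim k)
      have "a k powr (1 / real k) \<le> (C * s ^ k) powr (1 / real k)"
        by (intro powr_mono2 C nonneg) simp
      also have "\<dots> = C powr (1 / real k) * s"
        using elim \<open>s > 0\<close> C(1) by (simp add: powr_mult powr_powr flip: powr_realpow)
      finally show ?case using elim by simp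
    qed
  qed
qed

section \<open>Laws of random matrix products\<close>

text \<open>The complement of the support is the union of all open null sets. The Lindelof property
  reduces it to a countable union, which is again null.\<close>

lemma AE_in_msupport:
  fixes M :: "'a::second_countable_topology measure"
  assumes "sets M = sets borel"
  shows "AE x in M. x \<in> msupport M"
proof -
  define F where "F = {U. open U \<and> emeasure M U = 0}"
  obtain F' where F': "F' \<subseteq> F" "countable F'" "\<Union>F' = \<Union>F"
    using Lindelof[of F] by (auto simp: F_def)
  have "(\<Union>U\<in>F'. U) \<in> null_sets M"
    using F' assms by (intro null_sets_UN') (auto simp: F_def null_sets_def)
  moreover have "\<Union>F' = - msupport M"
    unfolding F'(3) by (auto simp: F_def msupport_def not_gr_zero)
  ultimately have "- msupport M \<in> null_sets M"
    by simp
  from AE_not_in[OF this] show ?thesis by simp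
qed

text \<open>An almost sure norm bound makes every continuous function integrable and passes to
  products of independent factors.\<close>

definition bounded_law :: "'a::euclidean_space measure \<Rightarrow> bool" where
  "bounded_law M \<longleftrightarrow> prob_space M \<and> sets M = sets borel \<and> (\<exists>R. AE x in M. norm x \<le> R)"

lemma bounded_law_prob_space: "bounded_law M \<Longrightarrow> prob_space M"
  and bounded_law_sets: "bounded_law M \<Longrightarrow> sets M = sets borel"
  by (simp_all add: bounded_law_def)

lemma bounded_law_if_bounded_msupport:
  assumes "prob_space M" "sets M = sets borel" "bounded (msupport M)"
  shows "bounded_law M"
proof -
  obtain R where "\<And>x. x \<in> msupport M \<Longrightarrow> norm x \<le> R"
    using assms(3) by (auto simp: bounded_iff)
  then have "AE x in M. norm x \<le> R"
    using AE_in_msupport[OF assms(2)] by (auto elim: eventually_mono)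
  then show ?thesis
    using assms by (auto simp: bounded_law_def)
qed

lemma bounded_law_return: "bounded_law (return borel x)"
  unfolding bounded_law_def
  by (intro conjI prob_space_return exI[of _ "norm x"]) (simp_all add: AE_return)

text \<open>Up to a null set the mass lies in a compact ball, on which a continuous function is
  bounded.\<close>

lemma integrable_bounded_law:
  fixes f :: "'a::euclidean_space \<Rightarrow> real"
  assumes "bounded_law M" "continuous_on UNIV f"
  shows "integrable M f"
proof -
  interpret prob_space M using assms(1) by (rule bounded_law_prob_space)
  obtain R where R: "AE x in M. norm x \<le> R"
    using assms(1) by (auto simp: bounded_law_def)
  have "compact (f ` cball 0 R)"
    using assms(2) by (intro compact_continuous_image) (auto intro: continuous_on_subset)
  then obtain B where "\<forall>y \<in> f ` cball 0 R. norm y \<le> B"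
    using compact_imp_bounded bounded_iff by blast
  then have B: "norm (f x) \<le> B" if "norm x \<le> R" for x
    using that by auto
  show ?thesis
  proof (rule integrable_const_bound[where B = B])
    show "AE x in M. norm (f x) \<le> B"
      using R by eventually_elim (rule B)
    show "f \<in> borel_measurable M"
      using borel_measurable_continuous_onI[OF assms(2)]
      by (simp add: measurable_cong_sets[OF bounded_law_sets[OF assms(1)] refl])
  qed
qed

section \<open>Law of a product of two independent matrices\<close>

lemma continuous_on_matrix_mult [continuous_intros]:
  fixes f :: "'a::topological_space \<Rightarrow> real^'n^'m" and g :: "'a \<Rightarrow> real^'k^'n"
  assumes "continuous_on S f" "continuous_on S g"
  shows "continuous_on S (\<lambda>x. f x ** g x)"
  unfolding matrix_matrix_mult_def by (intro continuous_intros assms)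

lemma continuous_on_matrix_vector_mult [continuous_intros]:
  fixes f :: "'a::topological_space \<Rightarrow> real^'n^'m" and g :: "'a \<Rightarrow> real^'n"
  assumes "continuous_on S f" "continuous_on S g"
  shows "continuous_on S (\<lambda>x. f x *v g x)"
  unfolding matrix_vector_mult_def by (intro continuous_intros assms)

text \<open>\<open>X\<close> and \<open>Y\<close> are independent, and the matrix drawn from the first law acts first.\<close>

definition mult_law :: "(real^'n^'n) measure \<Rightarrow> (real^'n^'n) measure \<Rightarrow> (real^'n^'n) measure" where
  "mult_law M N = distr (M \<Otimes>\<^sub>M N) borel (\<lambda>(X, Y). Y ** X)"

lemma measurable_matrix_mult:
  "(\<lambda>(X :: real^'n^'n, Y :: real^'n^'n). Y ** X) \<in> (borel \<Otimes>\<^sub>M borel) \<rightarrow>\<^sub>M borel"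
proof -
  have "(\<lambda>p :: (real^'n^'n) \<times> (real^'n^'n). snd p ** fst p) \<in> borel_measurable borel"
    by (intro borel_measurable_continuous_onI continuous_intros)
  then show ?thesis by (simp add: borel_prod case_prod_beta')
qed

lemma measurable_matrix_mult':
  assumes "bounded_law M" "bounded_law N"
  shows "(\<lambda>(X :: real^'n^'n, Y :: real^'n^'n). Y ** X) \<in> (M \<Otimes>\<^sub>M N) \<rightarrow>\<^sub>M borel"
  using measurable_matrix_mult
  by (subst measurable_cong_sets[OF sets_pair_measure_cong refl])
    (use assms in \<open>auto simp: bounded_law_sets\<close>)

text \<open>Multiplication is continuous, so it maps the product of two balls carrying the factors
  to a bounded set.\<close>

lemma bounded_law_mult_law:
  fixes M N :: "(real^'n^'n) measure"
  assumes M: "bounded_law M" and N: "bounded_law N"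
  shows "bounded_law (mult_law M N)"
proof -
  interpret M: prob_space M using M by (rule bounded_law_prob_space)
  interpret N: prob_space N using N by (rule bounded_law_prob_space)
  interpret pair_prob_space M N ..
  note [simp] = bounded_law_sets[OF M] bounded_law_sets[OF N]
  note meas = measurable_matrix_mult'[OF M N]
  obtain R where R: "AE x in M. norm x \<le> R"
    using M by (auto simp: bounded_law_def)
  obtain S where S: "AE x in N. norm x \<le> S"
    using N by (auto simp: bounded_law_def)
  have "compact ((\<lambda>p :: (real^'n^'n) \<times> (real^'n^'n). snd p ** fst p) ` (cball 0 R \<times> cball 0 S))"
    by (intro compact_continuous_image continuous_intros compact_Times compact_cball)
  then obtain B where "\<forall>z \<in> (\<lambda>p :: (real^'n^'n) \<times> (real^'n^'n). snd p ** fst p) `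
      (cball 0 R \<times> cball 0 S). norm z \<le> B"
    using compact_imp_bounded bounded_iff by blast
  then have B: "norm (Y ** X) \<le> B" if "norm X \<le> R" "norm Y \<le> S" for X Y :: "real^'n^'n"
    using that by force
  have cl: "{z. norm z \<le> B} \<in> sets (borel :: (real^'n^'n) measure)"
    by (intro borel_closed closed_Collect_le continuous_intros)
  have "AE X in M. AE Y in N. norm (Y ** X) \<le> B"
    using R by eventually_elim (use S in \<open>auto elim!: eventually_mono intro: B\<close>)
  moreover have "{p \<in> space (M \<Otimes>\<^sub>M N). norm (case p of (X, Y) \<Rightarrow> Y ** X) \<le> B} \<in> sets (M \<Otimes>\<^sub>M N)"
    using measurable_sets[OF meas cl] by (simp add: vimage_def Int_def conj_commute)
  ultimately have "AE p in M \<Otimes>\<^sub>M N. norm (case p of (X, Y) \<Rightarrow> Y ** X) \<le> B"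
    by (intro AE_pair_measure) auto
  then have "AE z in mult_law M N. norm z \<le> B"
    unfolding mult_law_def using cl by (subst AE_distr_iff[OF meas]) auto
  moreover have "prob_space (mult_law M N)"
    unfolding mult_law_def by (intro prob_space_distr meas)
  ultimately show ?thesis
    unfolding bounded_law_def by (auto simp: mult_law_def)
qed

text \<open>Tonelli's theorem for measurable functions; it covers indicators, so that laws can be
  compared on Borel sets.\<close>

lemma nn_integral_mult_law:
  assumes M: "bounded_law M" and N: "bounded_law N" and f: "f \<in> borel_measurable borel"
  shows "(\<integral>\<^sup>+Z. f Z \<partial>mult_law M N) = (\<integral>\<^sup>+X. \<integral>\<^sup>+Y. f (Y ** X) \<partial>N \<partial>M)"
proof -
  interpret N: prob_space N using N by (rule bounded_law_prob_space)
  have "(\<integral>\<^sup>+Z. f Z \<partial>mult_law M N) = (\<integral>\<^sup>+p. f (case p of (X, Y) \<Rightarrow> Y ** X) \<partial>(M \<Otimes>\<^sub>M N))"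
    unfolding mult_law_def using f by (intro nn_integral_distr measurable_matrix_mult' M N) simp
  also have "\<dots> = (\<integral>\<^sup>+X. \<integral>\<^sup>+Y. f (Y ** X) \<partial>N \<partial>M)"
    using measurable_compose[OF measurable_matrix_mult'[OF M N] f]
    by (subst N.nn_integral_fst[symmetric]) auto
  finally show ?thesis .
qed

text \<open>Fubini's theorem. Integrability over the product space holds because the law of the
  product is again bounded.\<close>

lemma integral_mult_law:
  fixes f :: "real^'n^'n \<Rightarrow> real"
  assumes M: "bounded_law M" and N: "bounded_law N" and f: "continuous_on UNIV f"
  shows "(\<integral>Z. f Z \<partial>mult_law M N) = (\<integral>X. \<integral>Y. f (Y ** X) \<partial>N \<partial>M)"
    and "integrable M (\<lambda>X. \<integral>Y. f (Y ** X) \<partial>N)"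
proof -
  interpret M: prob_space M using M by (rule bounded_law_prob_space)
  interpret N: prob_space N using N by (rule bounded_law_prob_space)
  interpret pair_prob_space M N ..
  note meas = measurable_matrix_mult'[OF M N]
  have f': "f \<in> borel_measurable borel"
    by (rule borel_measurable_continuous_onI[OF f])
  have int: "integrable (M \<Otimes>\<^sub>M N) (\<lambda>p. f (case p of (X, Y) \<Rightarrow> Y ** X))"
    using integrable_bounded_law[OF bounded_law_mult_law[OF M N] f]
    unfolding mult_law_def by (subst (asm) integrable_distr_eq[OF meas f'])
  have "(\<integral>Z. f Z \<partial>mult_law M N) = (\<integral>p. f (case p of (X, Y) \<Rightarrow> Y ** X) \<partial>(M \<Otimes>\<^sub>M N))"
    unfolding mult_law_def by (rule integral_distr[OF meas f'])
  also have "\<dots> = (\<integral>X. \<integral>Y. f (Y ** X) \<partial>N \<partial>M)"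
    using integral_fst'[OF int] by simp
  finally show "(\<integral>Z. f Z \<partial>mult_law M N) = (\<integral>X. \<integral>Y. f (Y ** X) \<partial>N \<partial>M)" .
  show "integrable M (\<lambda>X. \<integral>Y. f (Y ** X) \<partial>N)"
    using integrable_fst'[OF int] by simp
qed

lemma emeasure_mult_law:
  assumes "bounded_law M" "bounded_law N" "A \<in> sets borel"
  shows "emeasure (mult_law M N) A = (\<integral>\<^sup>+X. \<integral>\<^sup>+Y. indicator A (Y ** X) \<partial>N \<partial>M)"
  using nn_integral_mult_law[OF assms(1,2), of "indicator A"] assms(3)
  by (simp add: mult_law_def)

lemma measurable_nn_integral_mult_indicator:
  fixes N :: "(real^'n^'n) measure" and A :: "(real^'n^'n) set"
  assumes N: "bounded_law N" and A: "A \<in> sets borel"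
  shows "(\<lambda>X. \<integral>\<^sup>+Y. indicator A (Y ** X) \<partial>N) \<in> borel_measurable borel"
proof -
  interpret N: prob_space N using N by (rule bounded_law_prob_space)
  have eq: "sets (borel \<Otimes>\<^sub>M N) = sets (borel \<Otimes>\<^sub>M borel)"
    by (rule sets_pair_measure_cong[OF refl bounded_law_sets[OF N]])
  have "(\<lambda>p. indicator A (case p of (X :: real^'n^'n, Y :: real^'n^'n) \<Rightarrow> Y ** X) :: ennreal)
      \<in> borel_measurable (borel \<Otimes>\<^sub>M N)"
    using measurable_compose[OF measurable_matrix_mult borel_measurable_indicator[OF A]]
    unfolding measurable_cong_sets[OF eq refl] .
  from N.borel_measurable_nn_integral_fst[OF this] show ?thesis
    by simp
qed

text \<open>On a Borel set both sides become the same triple integral, by associativity of the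
  matrix product.\<close>

lemma mult_law_assoc:
  fixes L M N :: "(real^'n^'n) measure"
  assumes L: "bounded_law L" and M: "bounded_law M" and N: "bounded_law N"
  shows "mult_law (mult_law L M) N = mult_law L (mult_law M N)"
proof (rule measure_eqI)
  fix A assume "A \<in> sets (mult_law (mult_law L M) N)"
  then have A: "A \<in> sets borel"
    by (simp add: mult_law_def)
  have ind: "(indicator A :: _ \<Rightarrow> ennreal) \<in> borel_measurable borel"
    using A by simp
  have shift: "(\<lambda>Y. indicator A (Y ** X) :: ennreal) \<in> borel_measurable borel" for X :: "real^'n^'n"
    by (rule measurable_compose[OF _ ind]) (intro borel_measurable_continuous_onI continuous_intros)
  have "(\<lambda>X. \<integral>\<^sup>+Y. indicator A (Y ** X) \<partial>N) \<in> borel_measurable borel"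
    by (rule measurable_nn_integral_mult_indicator[OF N A])
  then have "emeasure (mult_law (mult_law L M) N) A
      = (\<integral>\<^sup>+X. \<integral>\<^sup>+Y. \<integral>\<^sup>+Z. indicator A (Z ** (Y ** X)) \<partial>N \<partial>M \<partial>L)"
    by (simp add: emeasure_mult_law nn_integral_mult_law bounded_law_mult_law L M N A)
  also have "\<dots> = emeasure (mult_law L (mult_law M N)) A"
    using shift
    by (simp add: emeasure_mult_law nn_integral_mult_law bounded_law_mult_law L M N A
        matrix_mul_assoc)
  finally show "emeasure (mult_law (mult_law L M) N) A = emeasure (mult_law L (mult_law M N)) A" .
qed (simp add: mult_law_def)

lemma mult_law_return_left:
  fixes M :: "(real^'n^'n) measure"
  assumes M: "bounded_law M"
  shows "mult_law (return borel (Finite_Cartesian_Product.mat 1)) M = M"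
proof (rule measure_eqI)
  fix A assume "A \<in> sets (mult_law (return borel (Finite_Cartesian_Product.mat 1)) M)"
  then have A: "A \<in> sets borel"
    by (simp add: mult_law_def)
  have "(\<lambda>X. \<integral>\<^sup>+Y. indicator A (Y ** X) \<partial>M) \<in> borel_measurable borel"
    by (rule measurable_nn_integral_mult_indicator[OF M A])
  then show "emeasure (mult_law (return borel (Finite_Cartesian_Product.mat 1)) M) A = emeasure M A"
    using A M by (simp add: emeasure_mult_law bounded_law_return nn_integral_return
        bounded_law_sets)
qed (simp add: mult_law_def bounded_law_sets M)

lemma mult_law_return_right:
  fixes M :: "(real^'n^'n) measure"
  assumes M: "bounded_law M"
  shows "mult_law M (return borel (Finite_Cartesian_Product.mat 1)) = M"
proof (rule measure_eqI)
  fix A assume "A \<in> sets (mult_law M (return borel (Finite_Cartesian_Product.mat 1)))"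
  then have A: "A \<in> sets borel"
    by (simp add: mult_law_def)
  have shift: "(\<lambda>Y. indicator A (Y ** X) :: ennreal) \<in> borel_measurable borel" for X :: "real^'n^'n"
    by (rule measurable_compose[OF _ borel_measurable_indicator[OF A]])
      (intro borel_measurable_continuous_onI continuous_intros)
  then show "emeasure (mult_law M (return borel (Finite_Cartesian_Product.mat 1))) A = emeasure M A"
    using A M by (simp add: emeasure_mult_law bounded_law_return nn_integral_return
        bounded_law_sets)
qed (simp add: mult_law_def bounded_law_sets M)

section \<open>Law of a product of \<open>k\<close> independent matrices\<close>

primrec product_law :: "(real^'n^'n) measure \<Rightarrow> nat \<Rightarrow> (real^'n^'n) measure" where
  "product_law \<mu> 0 = return borel (Finite_Cartesian_Product.mat 1)"
| "product_law \<mu> (Suc k) = mult_law (product_law \<mu> k) \<mu>"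

lemma bounded_law_product_law: "bounded_law \<mu> \<Longrightarrow> bounded_law (product_law \<mu> k)"
  by (induction k) (simp_all add: bounded_law_return bounded_law_mult_law)

lemma product_law_add:
  assumes "bounded_law \<mu>"
  shows "product_law \<mu> (m + k) = mult_law (product_law \<mu> m) (product_law \<mu> k)"
  using assms
  by (induction k) (simp_all add: mult_law_return_right mult_law_assoc bounded_law_product_law)

text \<open>The definition appends the factor that acts last; here the factor that acts first is
  peeled off, the form needed for the recursion of the Gram matrices.\<close>

lemma product_law_Suc:
  assumes "bounded_law \<mu>"
  shows "product_law \<mu> (Suc k) = mult_law \<mu> (product_law \<mu> k)"
  using product_law_add[OF assms, of 1 k] mult_law_return_left[OF assms] by simp

lemma measurable_left_product:
  assumes "sets \<mu> = sets borel"
  shows "(\<lambda>\<omega>. left_product \<omega> k) \<in> iid_space \<mu> \<rightarrow>\<^sub>M (borel :: (real^'n^'n) measure)"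
proof (induction k)
  case (Suc k)
  have "(\<lambda>\<omega>. \<omega> (Suc k)) \<in> iid_space \<mu> \<rightarrow>\<^sub>M (borel :: (real^'n^'n) measure)"
    unfolding iid_space_def measurable_cong_sets[OF refl assms[symmetric]]
    by (rule measurable_component_singleton) simp
  from measurable_compose[OF measurable_Pair[OF Suc this] measurable_matrix_mult]
  show ?case by simp
qed simp

lemma left_product_cong:
  "(\<And>i. 1 \<le> i \<Longrightarrow> i \<le> k \<Longrightarrow> A i = B i) \<Longrightarrow> left_product A k = left_product B k"
  by (induction k) auto

text \<open>An independent sequence has the same law as two such sequences glued together after
  coordinate \<open>k\<close>. The product of the first \<open>k\<close> matrices then depends only
  on one of them and the new factor only on the other, which yields a product measure.\<close>

lemma distr_left_product:
  fixes \<mu> :: "(real^'n^'n) measure"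
  assumes "bounded_law \<mu>"
  shows "distr (iid_space \<mu>) borel (\<lambda>\<omega>. left_product \<omega> k) = product_law \<mu> k"
proof -
  interpret \<mu>: prob_space \<mu> using assms by (rule bounded_law_prob_space)
  interpret sequence_space \<mu> ..
  let ?S = "iid_space \<mu>"
  have S: "?S = (\<Pi>\<^sub>M i\<in>UNIV::nat set. \<mu>)"
    by (simp add: iid_space_def)
  interpret S: prob_space ?S
    unfolding S by (intro prob_space_PiM \<mu>.prob_space_axioms)
  note sets = bounded_law_sets[OF assms]
  note lp = measurable_left_product[OF sets]
  show ?thesis
  proof (induction k)
    case 0
    show ?case
      by (simp add: S.distr_const)
  next
    case (Suc k)
    have proj: "(\<lambda>\<omega>. \<omega> 0) \<in> ?S \<rightarrow>\<^sub>M \<mu>"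
      unfolding S by (rule measurable_component_singleton) simp
    have law0: "distr ?S \<mu> (\<lambda>\<omega>. \<omega> 0) = \<mu>"
      unfolding S by (rule PiM_component) simp
    have "distr ?S borel (\<lambda>\<omega>. left_product \<omega> (Suc k))
        = distr (distr (?S \<Otimes>\<^sub>M ?S) ?S (\<lambda>(\<omega>, \<omega>'). comb_seq (Suc k) \<omega> \<omega>')) borel
            (\<lambda>\<omega>. left_product \<omega> (Suc k))"
      using PiM_comb_seq[of "Suc k"] by (simp add: S)
    also have "\<dots> = distr (?S \<Otimes>\<^sub>M ?S) borel
        ((\<lambda>\<omega>. left_product \<omega> (Suc k)) \<circ> (\<lambda>(\<omega>, \<omega>'). comb_seq (Suc k) \<omega> \<omega>'))"
      using measurable_comb_seq[of "Suc k" \<mu>] by (intro distr_distr lp) (simp add: S)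
    \<comment> \<open>With the cut at \<open>Suc k\<close>, coordinates 1 to \<open>k\<close> come
      from \<open>\<omega>\<close>, while coordinate \<open>Suc k\<close> is coordinate 0 of
      \<open>\<omega>'\<close>.\<close>
    also have "(\<lambda>\<omega>. left_product \<omega> (Suc k)) \<circ> (\<lambda>(\<omega>, \<omega>'). comb_seq (Suc k) \<omega> \<omega>')
        = (\<lambda>(X, Y). Y ** X) \<circ> (\<lambda>(\<omega>, \<omega>'). (left_product \<omega> k, \<omega>' 0))"
      by (auto simp: fun_eq_iff comb_seq_def intro!: arg_cong2[where f = "(**)"] left_product_cong)
    also have "distr (?S \<Otimes>\<^sub>M ?S) borel \<dots>
        = distr (distr (?S \<Otimes>\<^sub>M ?S) (borel \<Otimes>\<^sub>M \<mu>) (\<lambda>(\<omega>, \<omega>'). (left_product \<omega> k, \<omega>' 0))) borel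
            (\<lambda>(X, Y). Y ** X)"
    proof (rule distr_distr[symmetric])
      show "(\<lambda>(X, Y). Y ** X) \<in> (borel \<Otimes>\<^sub>M \<mu>) \<rightarrow>\<^sub>M (borel :: (real^'n^'n) measure)"
        using measurable_matrix_mult
        by (subst measurable_cong_sets[OF sets_pair_measure_cong refl]) (auto simp: sets)
      show "(\<lambda>(\<omega>, \<omega>'). (left_product \<omega> k, \<omega>' 0)) \<in> ?S \<Otimes>\<^sub>M ?S \<rightarrow>\<^sub>M borel \<Otimes>\<^sub>M \<mu>"
        unfolding case_prod_beta'
        by (intro measurable_Pair measurable_compose[OF measurable_fst lp]
            measurable_compose[OF measurable_snd proj])
    qed
    also have "distr (?S \<Otimes>\<^sub>M ?S) (borel \<Otimes>\<^sub>M \<mu>) (\<lambda>(\<omega>, \<omega>'). (left_product \<omega> k, \<omega>' 0))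
        = distr ?S borel (\<lambda>\<omega>. left_product \<omega> k) \<Otimes>\<^sub>M distr ?S \<mu> (\<lambda>\<omega>. \<omega> 0)"
      by (intro pair_measure_distr[symmetric] lp proj) (simp add: law0 \<mu>.sigma_finite_measure_axioms)
    also have "distr \<dots> borel (\<lambda>(X, Y). Y ** X) = product_law \<mu> (Suc k)"
      unfolding Suc law0 by (simp add: mult_law_def)
    finally show ?case .
  qed
qed

section \<open>Kronecker powers\<close>

lemma dim_kronecker [simp]:
  "dim_row (X \<otimes>\<^sub>K Y) = dim_row X * dim_row Y" "dim_col (X \<otimes>\<^sub>K Y) = dim_col X * dim_col Y"
  by (simp_all add: kronecker_def)

lemma index_kronecker:
  "i < dim_row X * dim_row Y \<Longrightarrow> j < dim_col X * dim_col Y \<Longrightarrow>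
    (X \<otimes>\<^sub>K Y) $$ (i, j)
      = X $$ (i div dim_row Y, j div dim_col Y) * Y $$ (i mod dim_row Y, j mod dim_col Y)"
  by (simp add: kronecker_def)

lemma mod_less_if_less_mult: "i < m * n \<Longrightarrow> i mod n < n" for i m n :: nat
  by (cases n) auto

text \<open>Mixed product rule: the summation index of the left side is split into quotient and
  remainder, and the resulting double sum factors.\<close>

lemma kronecker_mult_kronecker:
  assumes "dim_col A = dim_row C" "dim_col B = dim_row D"
  shows "(A \<otimes>\<^sub>K B) * (C \<otimes>\<^sub>K D) = (A * C) \<otimes>\<^sub>K (B * D)"
proof (rule eq_matI)
  fix i j assume "i < dim_row ((A * C) \<otimes>\<^sub>K (B * D))" "j < dim_col ((A * C) \<otimes>\<^sub>K (B * D))"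
  then have i: "i < dim_row A * dim_row B" and j: "j < dim_col C * dim_col D"
    by simp_all
  note less = less_mult_imp_div_less[OF i] mod_less_if_less_mult[OF i]
    less_mult_imp_div_less[OF j] mod_less_if_less_mult[OF j]
  let ?i = "i div dim_row B" and ?i' = "i mod dim_row B"
  let ?j = "j div dim_col D" and ?j' = "j mod dim_col D"
  have "((A \<otimes>\<^sub>K B) * (C \<otimes>\<^sub>K D)) $$ (i, j)
      = (\<Sum>k<dim_row C * dim_row D. (A \<otimes>\<^sub>K B) $$ (i, k) * (C \<otimes>\<^sub>K D) $$ (k, j))"
    using i j assms by (simp add: scalar_prod_def atLeast0LessThan)
  also have "\<dots> = (\<Sum>k<dim_row C. \<Sum>l<dim_row D.
      (A \<otimes>\<^sub>K B) $$ (i, l + k * dim_row D) * (C \<otimes>\<^sub>K D) $$ (l + k * dim_row D, j))"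
    by (rule sum_mult_product)
  also have "\<dots> = (\<Sum>k<dim_row C. \<Sum>l<dim_row D.
      (A $$ (?i, k) * C $$ (k, ?j)) * (B $$ (?i', l) * D $$ (l, ?j')))"
  proof (intro sum.cong refl)
    fix k l assume "k \<in> {..<dim_row C}" "l \<in> {..<dim_row D}"
    then have "l + k * dim_row D < Suc k * dim_row D" "Suc k \<le> dim_row C"
      by simp_all
    moreover from this(2) have "Suc k * dim_row D \<le> dim_row C * dim_row D"
      by (rule mult_le_mono1)
    ultimately have kl: "l + k * dim_row D < dim_row C * dim_row D"
      by linarith
    with \<open>l \<in> _\<close> show "(A \<otimes>\<^sub>K B) $$ (i, l + k * dim_row D) * (C \<otimes>\<^sub>K D) $$ (l + k * dim_row D, j)
        = (A $$ (?i, k) * C $$ (k, ?j)) * (B $$ (?i', l) * D $$ (l, ?j'))"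
      using i j by (simp add: index_kronecker assms)
  qed
  also have "\<dots> = (\<Sum>k<dim_row C. A $$ (?i, k) * C $$ (k, ?j))
      * (\<Sum>l<dim_row D. B $$ (?i', l) * D $$ (l, ?j'))"
    by (simp add: sum_product)
  also have "\<dots> = ((A * C) \<otimes>\<^sub>K (B * D)) $$ (i, j)"
    using i j less by (simp add: index_kronecker scalar_prod_def atLeast0LessThan assms)
  finally show "((A \<otimes>\<^sub>K B) * (C \<otimes>\<^sub>K D)) $$ (i, j) = ((A * C) \<otimes>\<^sub>K (B * D)) $$ (i, j)" .
qed simp_all

lemma transpose_kronecker: "transpose_mat (X \<otimes>\<^sub>K Y) = transpose_mat X \<otimes>\<^sub>K transpose_mat Y"
proof (rule eq_matI)
  fix i j
  assume "i < dim_row (transpose_mat X \<otimes>\<^sub>K transpose_mat Y)"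
    "j < dim_col (transpose_mat X \<otimes>\<^sub>K transpose_mat Y)"
  then have i: "i < dim_col X * dim_col Y" and j: "j < dim_row X * dim_row Y"
    by simp_all
  then show "transpose_mat (X \<otimes>\<^sub>K Y) $$ (i, j) = (transpose_mat X \<otimes>\<^sub>K transpose_mat Y) $$ (i, j)"
    using less_mult_imp_div_less[OF i] mod_less_if_less_mult[OF i]
      less_mult_imp_div_less[OF j] mod_less_if_less_mult[OF j]
    by (simp add: index_kronecker)
qed simp_all

lemma dim_kronecker_power [simp]:
  "dim_row (kronecker_power X q) = dim_row X ^ q" "dim_col (kronecker_power X q) = dim_col X ^ q"
  by (induction q) (simp_all add: mult.commute)

lemma kronecker_power_mult:
  "dim_col A = dim_row B \<Longrightarrow> kronecker_power (A * B) q = kronecker_power A q * kronecker_power B q"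
  by (induction q) (simp_all add: kronecker_mult_kronecker)

lemma transpose_kronecker_power:
  "transpose_mat (kronecker_power X q) = kronecker_power (transpose_mat X) q"
  by (induction q) (simp_all add: transpose_kronecker)

lemma kronecker_power_one: "kronecker_power (1\<^sub>m n) q = 1\<^sub>m (n ^ q)"
proof (induction q)
  case (Suc q)
  show ?case
  proof (rule eq_matI)
    fix i j assume "i < dim_row (1\<^sub>m (n ^ Suc q))" "j < dim_col (1\<^sub>m (n ^ Suc q))"
    then have i: "i < n ^ q * n" and j: "j < n ^ q * n"
      by (simp_all add: mult.commute)
    have "i div n = j div n \<and> i mod n = j mod n \<longleftrightarrow> i = j"
      by (metis div_mult_mod_eq)
    then show "kronecker_power (1\<^sub>m n) (Suc q) $$ (i, j) = 1\<^sub>m (n ^ Suc q) $$ (i, j)"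
      using i j less_mult_imp_div_less[OF i] mod_less_if_less_mult[OF i]
        less_mult_imp_div_less[OF j] mod_less_if_less_mult[OF j]
      by (auto simp: Suc index_kronecker mult.commute)
  qed (simp_all add: mult.commute)
qed simp

text \<open>Collects the index bounds together with the recursion for an entry, for the entrywise
  inductions below.\<close>

lemma kronecker_power_entry_Suc:
  assumes "i < dim_row X ^ Suc q" "j < dim_col X ^ Suc q"
  shows "i div dim_row X < dim_row X ^ q" "i mod dim_row X < dim_row X"
    "j div dim_col X < dim_col X ^ q" "j mod dim_col X < dim_col X"
    "kronecker_power X (Suc q) $$ (i, j)
      = kronecker_power X q $$ (i div dim_row X, j div dim_col X)
        * X $$ (i mod dim_row X, j mod dim_col X)"
proof -
  have i: "i < dim_row X ^ q * dim_row X" and j: "j < dim_col X ^ q * dim_col X"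
    using assms by (simp_all add: mult.commute)
  show "i div dim_row X < dim_row X ^ q" "i mod dim_row X < dim_row X"
    "j div dim_col X < dim_col X ^ q" "j mod dim_col X < dim_col X"
    using less_mult_imp_div_less[OF i] mod_less_if_less_mult[OF i]
      less_mult_imp_div_less[OF j] mod_less_if_less_mult[OF j] by simp_all
  show "kronecker_power X (Suc q) $$ (i, j)
      = kronecker_power X q $$ (i div dim_row X, j div dim_col X)
        * X $$ (i mod dim_row X, j mod dim_col X)"
    using i j by (simp add: index_kronecker)
qed

lemma kronecker_power_smult:
  "kronecker_power (c \<cdot>\<^sub>m X) q = c ^ q \<cdot>\<^sub>m kronecker_power X q"
proof (induction q)
  case (Suc q)
  show ?case
  proof (rule eq_matI)
    fix i j
    assume "i < dim_row (c ^ Suc q \<cdot>\<^sub>m kronecker_power X (Suc q))"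
      "j < dim_col (c ^ Suc q \<cdot>\<^sub>m kronecker_power X (Suc q))"
    then have ij: "i < dim_row X ^ Suc q" "j < dim_col X ^ Suc q"
      by (simp_all only: index_smult_mat dim_kronecker_power)
    note * = kronecker_power_entry_Suc[OF ij]
    have "kronecker_power (c \<cdot>\<^sub>m X) (Suc q) $$ (i, j)
        = kronecker_power (c \<cdot>\<^sub>m X) q $$ (i div dim_row X, j div dim_col X)
          * (c \<cdot>\<^sub>m X) $$ (i mod dim_row X, j mod dim_col X)"
      using kronecker_power_entry_Suc(5)[of i "c \<cdot>\<^sub>m X" q j] ij by simp
    also have "\<dots> = c ^ Suc q * kronecker_power X (Suc q) $$ (i, j)"
      using * by (simp only: Suc index_smult_mat dim_kronecker_power) simp
    also have "\<dots> = (c ^ Suc q \<cdot>\<^sub>m kronecker_power X (Suc q)) $$ (i, j)"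
      using ij by (simp only: index_smult_mat dim_kronecker_power)
    finally show "kronecker_power (c \<cdot>\<^sub>m X) (Suc q) $$ (i, j)
        = (c ^ Suc q \<cdot>\<^sub>m kronecker_power X (Suc q)) $$ (i, j)" .
  qed simp_all
qed (rule eq_matI; simp)

text \<open>An entry of the \<open>q\<close>-fold power is a product of \<open>q\<close> entries of
  \<open>X\<close>.\<close>

lemma abs_kronecker_power_entry_le:
  assumes "\<And>i j. i < dim_row X \<Longrightarrow> j < dim_col X \<Longrightarrow> \<bar>X $$ (i, j)\<bar> \<le> c"
    and "i < dim_row X ^ q" "j < dim_col X ^ q"
  shows "\<bar>kronecker_power X q $$ (i, j)\<bar> \<le> c ^ q"
  using assms(2,3)
proof (induction q arbitrary: i j)
  case (Suc q)
  note * = kronecker_power_entry_Suc[OF Suc.prems]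
  have "\<bar>X $$ (i mod dim_row X, j mod dim_col X)\<bar> \<le> c"
    using * by (intro assms(1))
  moreover have "0 \<le> c"
    using calculation by linarith
  ultimately have "\<bar>kronecker_power X q $$ (i div dim_row X, j div dim_col X)\<bar>
      * \<bar>X $$ (i mod dim_row X, j mod dim_col X)\<bar> \<le> c ^ q * c"
    using * by (intro mult_mono Suc.IH) auto
  then show ?case
    unfolding *(5) by (simp add: abs_mult mult.commute)
qed simp

lemma continuous_on_kronecker_power_entry:
  fixes F :: "'a::topological_space \<Rightarrow> real mat"
  assumes dim: "\<And>x. dim_row (F x) = m" "\<And>x. dim_col (F x) = n"
    and cont: "\<And>i j. i < m \<Longrightarrow> j < n \<Longrightarrow> continuous_on UNIV (\<lambda>x. F x $$ (i, j))"
    and "i < m ^ q" "j < n ^ q"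
  shows "continuous_on UNIV (\<lambda>x. kronecker_power (F x) q $$ (i, j))"
  using assms(4,5)
proof (induction q arbitrary: i j)
  case (Suc q)
  have eq: "kronecker_power (F x) (Suc q) $$ (i, j)
      = kronecker_power (F x) q $$ (i div m, j div n) * F x $$ (i mod m, j mod n)" for x
    using kronecker_power_entry_Suc(5)[of i "F x" q j] Suc.prems dim by simp
  have "i < m ^ q * m" "j < n ^ q * n"
    using Suc.prems by (simp_all add: mult.commute)
  then show ?case
    unfolding eq
    by (intro continuous_intros Suc.IH cont) (auto intro: less_mult_imp_div_less mod_less_if_less_mult)
qed simp

section \<open>Numbering of indices, and Kronecker lifts of matrices and vectors\<close>

lemma bij_betw_enum_index: "bij_betw (enum_index :: nat \<Rightarrow> 'n::finite) {..<CARD('n)} UNIV"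
  by (rule bij_betw_from_nat_into_finite) simp

lemma sum_enum_index: "(\<Sum>k<CARD('n). f (enum_index k)) = (\<Sum>k\<in>(UNIV :: 'n::finite set). f k)"
  by (rule sum.reindex_bij_betw[OF bij_betw_enum_index])

lemma dim_numbered [simp]:
  "dim_row (numbered_mat (A :: real^'n^'n)) = CARD('n)" "dim_col (numbered_mat A) = CARD('n)"
  "dim_row (numbered_col (x :: real^'n)) = CARD('n)" "dim_col (numbered_col x) = 1"
  by (simp_all add: numbered_mat_def numbered_col_def)

lemma numbered_mat_mult: "numbered_mat (A ** B) = numbered_mat A * numbered_mat B"
  for A B :: "real^'n^'n"
  by (rule eq_matI)
    (auto simp: numbered_mat_def scalar_prod_def atLeast0LessThan matrix_matrix_mult_def
      sum_enum_index[symmetric])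

lemma numbered_col_mult: "numbered_col (A *v x) = numbered_mat A * numbered_col x"
  for A :: "real^'n^'n"
  by (rule eq_matI)
    (auto simp: numbered_mat_def numbered_col_def scalar_prod_def atLeast0LessThan
      matrix_vector_mult_def
      sum_enum_index[symmetric])

lemma numbered_mat_one: "numbered_mat (Finite_Cartesian_Product.mat 1 :: real^'n^'n) = 1\<^sub>m CARD('n)"
proof (rule eq_matI)
  fix i j assume "i < dim_row (1\<^sub>m CARD('n) :: real mat)" "j < dim_col (1\<^sub>m CARD('n) :: real mat)"
  moreover from this have "(enum_index i :: 'n) = enum_index j \<longleftrightarrow> i = j"
    using bij_betw_imp_inj_on[OF bij_betw_enum_index[where 'n = 'n]] by (auto simp: inj_on_def)
  ultimately show "numbered_mat (Finite_Cartesian_Product.mat 1 :: real^'n^'n) $$ (i, j)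
      = 1\<^sub>m CARD('n) $$ (i, j)"
    by (simp add: numbered_mat_def Finite_Cartesian_Product.mat_def)
qed (simp_all add: numbered_mat_def)

definition kron_mat :: "nat \<Rightarrow> real^'n^'n \<Rightarrow> real mat" where
  "kron_mat q A = kronecker_power (numbered_mat A) q"

text \<open>A vector instead of a one-column matrix, to fit the quadratic forms in the definitions
  of definiteness.\<close>

definition kron_vec :: "nat \<Rightarrow> real^'n \<Rightarrow> real Matrix.vec" where
  "kron_vec q x = Matrix.col (kronecker_power (numbered_col x) q) 0"

lemma kron_mat_carrier: "kron_mat q (A :: real^'n^'n) \<in> carrier_mat (CARD('n) ^ q) (CARD('n) ^ q)"
  by (rule carrier_matI) (simp_all add: kron_mat_def)

lemma kron_vec_carrier: "kron_vec q (x :: real^'n) \<in> carrier_vec (CARD('n) ^ q)"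
  by (rule carrier_vecI) (simp add: kron_vec_def)

lemma kron_mat_mult: "kron_mat q (A ** B) = kron_mat q A * kron_mat q B"
  for A B :: "real^'n^'n"
  by (simp add: kron_mat_def numbered_mat_mult kronecker_power_mult)

lemma kron_mat_one:
  "kron_mat q (Finite_Cartesian_Product.mat 1 :: real^'n^'n) = 1\<^sub>m (CARD('n) ^ q)"
  by (simp add: kron_mat_def numbered_mat_one kronecker_power_one)

text \<open>Multiplicativity of Kronecker powers makes the step from \<open>x\<close> to
  \<open>A *v x\<close> a linear map on lifted vectors; this links the growth condition to a matrix
  inequality.\<close>

lemma kron_vec_mult: "kron_vec q (A *v x) = kron_mat q A *\<^sub>v kron_vec q x"
  for A :: "real^'n^'n"
proof -
  have "kronecker_power (numbered_col x) q \<in> carrier_mat (CARD('n) ^ q) 1"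
    by (rule carrier_matI) simp_all
  from col_mult2[OF kron_mat_carrier this, of 0 A] show ?thesis
    by (simp add: kron_vec_def kron_mat_def numbered_col_mult kronecker_power_mult)
qed

lemma kron_vec_scaleR: "kron_vec q (c *\<^sub>R x) = c ^ q \<cdot>\<^sub>v kron_vec q x"
  for x :: "real^'n"
proof -
  have "numbered_col (c *\<^sub>R x) = c \<cdot>\<^sub>m numbered_col x"
    by (rule eq_matI) (auto simp: numbered_col_def)
  then show ?thesis
    by (auto simp: kron_vec_def kronecker_power_smult intro!: eq_vecI)
qed

text \<open>The product \<open>X\<^sup>T X\<close> is the 1 by 1 matrix with entry
  \<open>(norm x)\<^sup>2\<close>, and Kronecker powers commute with products and transposes. In
  particular, the lift of a nonzero vector is nonzero.\<close>

lemma scalar_prod_kron_vec: "scalar_prod (kron_vec q x) (kron_vec q x) = norm x ^ (2 * q)"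
  for x :: "real^'n"
proof -
  let ?X = "numbered_col x"
  have "transpose_mat ?X * ?X = (norm x)\<^sup>2 \<cdot>\<^sub>m 1\<^sub>m 1"
    by (rule eq_matI) (auto simp: scalar_prod_def numbered_col_def atLeast0LessThan
      power2_norm_eq_inner inner_vec_def sum_enum_index[symmetric])
  then have "kronecker_power (transpose_mat ?X * ?X) q = ((norm x)\<^sup>2) ^ q \<cdot>\<^sub>m 1\<^sub>m 1"
    by (simp add: kronecker_power_smult kronecker_power_one)
  then have "transpose_mat (kronecker_power ?X q) * kronecker_power ?X q = norm x ^ (2 * q) \<cdot>\<^sub>m 1\<^sub>m 1"
    by (simp add: kronecker_power_mult transpose_kronecker_power power_mult)
  from arg_cong[OF this, of "\<lambda>B. B $$ (0, 0)"] show ?thesis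
    by (simp add: kron_vec_def)
qed

lemma abs_kron_mat_entry_le:
  fixes A :: "real^'n^'n"
  assumes "i < CARD('n) ^ q" "j < CARD('n) ^ q"
  shows "\<bar>kron_mat q A $$ (i, j)\<bar> \<le> spectral_norm A ^ q"
  unfolding kron_mat_def using assms
  by (intro abs_kronecker_power_entry_le)
    (simp_all add: numbered_mat_def abs_component_le_spectral_norm)

lemma continuous_on_kron_mat_entry:
  assumes "i < CARD('n) ^ q" "j < CARD('n) ^ q"
  shows "continuous_on UNIV (\<lambda>A :: real^'n^'n. kron_mat q A $$ (i, j))"
  unfolding kron_mat_def using assms
  by (intro continuous_on_kronecker_power_entry[where m = "CARD('n)" and n = "CARD('n)"])
    (auto simp: numbered_mat_def intro!: continuous_intros)

lemma continuous_on_kron_vec_entry: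
  assumes "i < CARD('n) ^ q"
  shows "continuous_on UNIV (\<lambda>x :: real^'n. vec_index (kron_vec q x) i)"
proof -
  have "vec_index (kron_vec q x) i = kronecker_power (numbered_col x) q $$ (i, 0)" for x :: "real^'n"
    using assms by (simp add: kron_vec_def)
  then show ?thesis
    using assms
    by (simp, intro continuous_on_kronecker_power_entry[where m = "CARD('n)" and n = 1])
      (auto simp: numbered_col_def intro!: continuous_intros)
qed

section \<open>Quadratic forms in terms of matrix entries\<close>

lemma scalar_prod_mult_mat_vec:
  fixes B :: "real mat"
  assumes "B \<in> carrier_mat N N" "v \<in> carrier_vec N"
  shows "scalar_prod v (B *\<^sub>v v) = (\<Sum>i<N. \<Sum>j<N. vec_index v i * vec_index v j * B $$ (i, j))"
  using assms by (simp add: scalar_prod_def atLeast0LessThan sum_distrib_left mult_ac)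

lemma transpose_mult_mult_entry:
  fixes B :: "real mat"
  assumes "K \<in> carrier_mat N n" "B \<in> carrier_mat N N" "i < n" "j < n"
  shows "(transpose_mat K * B * K) $$ (i, j)
    = (\<Sum>a<N. \<Sum>b<N. K $$ (a, i) * K $$ (b, j) * B $$ (a, b))"
  using assms by (simp add: scalar_prod_def atLeast0LessThan sum_distrib_left mult_ac)

text \<open>The transposed factor moves to the other side of the scalar product. With
  \<open>K\<close> the lift of \<open>A\<close>, this relates the form at the next state to the
  matrix under the expectation.\<close>

lemma scalar_prod_congruence:
  fixes B :: "real mat"
  assumes "K \<in> carrier_mat N N" "B \<in> carrier_mat N N" "v \<in> carrier_vec N"
  shows "scalar_prod v ((transpose_mat K * B * K) *\<^sub>v v)
    = scalar_prod (K *\<^sub>v v) (B *\<^sub>v (K *\<^sub>v v))"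
proof -
  have "(transpose_mat K * B * K) *\<^sub>v v = transpose_mat K *\<^sub>v (B *\<^sub>v (K *\<^sub>v v))"
    using assms by (simp add: assoc_mult_mat_vec[where n\<^sub>1 = N and n\<^sub>2 = N and n\<^sub>3 = N])
  moreover have "scalar_prod v (transpose_mat K *\<^sub>v w) = scalar_prod (K *\<^sub>v v) w"
    if w: "w \<in> carrier_vec N" for w
  proof -
    have "scalar_prod (transpose_mat K *\<^sub>v w) v = scalar_prod w (K *\<^sub>v v)"
      by (rule transpose_vec_mult_scalar[OF assms(1,3) w])
    moreover have "transpose_mat K *\<^sub>v w \<in> carrier_vec N" "K *\<^sub>v v \<in> carrier_vec N"
      using assms w by auto
    ultimately show ?thesis
      using comm_scalar_prod assms(3) w by metis
  qed
  ultimately show ?thesis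
    using assms by simp
qed

lemma kronecker_form_eq:
  fixes x :: "real^'n"
  assumes "H \<in> carrier_mat (CARD('n) ^ q) (CARD('n) ^ q)"
  shows "kronecker_form q H x = scalar_prod (kron_vec q x) (H *\<^sub>v kron_vec q x)"
proof -
  let ?K = "kronecker_power (numbered_col x) q"
  have K: "?K \<in> carrier_mat (CARD('n) ^ q) 1"
    by (rule carrier_matI) simp_all
  have "kronecker_form q H x
      = (\<Sum>a<CARD('n) ^ q. \<Sum>b<CARD('n) ^ q. ?K $$ (a, 0) * ?K $$ (b, 0) * H $$ (a, b))"
    unfolding kronecker_form_def by (rule transpose_mult_mult_entry[OF K assms]) auto
  also have "\<dots> = scalar_prod (kron_vec q x) (H *\<^sub>v kron_vec q x)"
    by (subst scalar_prod_mult_mat_vec[OF assms kron_vec_carrier]) (simp add: kron_vec_def)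
  finally show ?thesis .
qed

section \<open>The matrix inequality\<close>

definition moment :: "nat \<Rightarrow> (real^'n^'n) measure \<Rightarrow> nat \<Rightarrow> real" where
  "moment p \<mu> k = (\<integral>\<Phi>. spectral_norm \<Phi> ^ p \<partial>product_law \<mu> k)"

lemma continuous_on_spectral_norm_power:
  "continuous_on UNIV (\<lambda>A :: real^'n^'n. spectral_norm A ^ p)"
  by (intro continuous_intros continuous_on_spectral_norm)

lemma moment_nonneg: "0 \<le> moment p \<mu> k"
  unfolding moment_def by (intro Bochner_Integration.integral_nonneg) (simp add: spectral_norm_nonneg)

text \<open>The product splits into two independent blocks, and the submultiplicative bound on the
  spectral norm makes the iterated integral factor.\<close>

lemma moment_add_le:
  fixes \<mu> :: "(real^'n^'n) measure"
  assumes "bounded_law \<mu>"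
  shows "moment p \<mu> (m + k) \<le> moment p \<mu> m * moment p \<mu> k"
proof -
  let ?s = "\<lambda>A :: real^'n^'n. spectral_norm A ^ p"
  note law = bounded_law_product_law[OF assms]
  have int: "integrable (product_law \<mu> k) ?s" for k
    by (rule integrable_bounded_law[OF law continuous_on_spectral_norm_power])
  have "moment p \<mu> (m + k) = (\<integral>X. \<integral>Y. ?s (Y ** X) \<partial>product_law \<mu> k \<partial>product_law \<mu> m)"
    unfolding moment_def product_law_add[OF assms]
    by (rule integral_mult_law(1)[OF law law continuous_on_spectral_norm_power])
  also have "\<dots> \<le> (\<integral>X. \<integral>Y. ?s Y * ?s X \<partial>product_law \<mu> k \<partial>product_law \<mu> m)"
  proof (rule integral_mono)
    show "integrable (product_law \<mu> m) (\<lambda>X. \<integral>Y. ?s (Y ** X) \<partial>product_law \<mu> k)"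
      by (rule integral_mult_law(2)[OF law law continuous_on_spectral_norm_power])
    show "integrable (product_law \<mu> m) (\<lambda>X. \<integral>Y. ?s Y * ?s X \<partial>product_law \<mu> k)"
      using int by simp
    fix X :: "real^'n^'n"
    show "(\<integral>Y. ?s (Y ** X) \<partial>product_law \<mu> k) \<le> (\<integral>Y. ?s Y * ?s X \<partial>product_law \<mu> k)"
    proof (rule integral_mono)
      show "integrable (product_law \<mu> k) (\<lambda>Y. ?s (Y ** X))"
        by (intro integrable_bounded_law[OF law] continuous_on_power
            continuous_on_compose2[OF continuous_on_spectral_norm] continuous_intros) auto
      show "integrable (product_law \<mu> k) (\<lambda>Y. ?s Y * ?s X)"
        using int by simp
      show "?s (Y ** X) \<le> ?s Y * ?s X" for Y
        unfolding power_mult_distrib[symmetric]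
        by (intro power_mono spectral_norm_mult_le spectral_norm_nonneg)
    qed
  qed
  also have "\<dots> = moment p \<mu> m * moment p \<mu> k"
    by (simp add: moment_def mult.commute)
  finally show ?thesis .
qed

text \<open>Fekete's lemma applied to the moments, with the root of order \<open>p * k\<close> taken
  as a \<open>p\<close>th root of a \<open>k\<close>th root. Existence of the limit gives
  \<open>lim\<close> its meaning.\<close>

lemma p_radius_eq:
  fixes \<mu> :: "(real^'n^'n) measure"
  assumes "bounded_law \<mu>" "p > 0"
  shows "p_radius p \<mu> = (INF k\<in>{1..}. moment p \<mu> k powr (1 / real k)) powr (1 / real p)"
    (is "_ = ?L powr _")
proof -
  have moment: "(\<integral>A. spectral_norm (left_product A k) ^ p \<partial>iid_space \<mu>) = moment p \<mu> k" for k
    unfolding moment_def distr_left_product[OF assms(1), symmetric]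
    by (intro integral_distr[symmetric] measurable_left_product bounded_law_sets assms(1)
        borel_measurable_continuous_onI continuous_on_spectral_norm_power)
  \<comment> \<open>The infimum may be 0; passing to the limit in \<open>powr\<close> is still
    justified because the exponent \<open>1 / real p\<close> is positive.\<close>
  have "(\<lambda>k. (moment p \<mu> k powr (1 / real k)) powr (1 / real p)) \<longlonglongrightarrow> ?L powr (1 / real p)"
    using assms(2)
    by (intro tendsto_powr' tendsto_const submultiplicative_root_tendsto moment_nonneg
        moment_add_le assms(1)) auto
  also have "(\<lambda>k. (moment p \<mu> k powr (1 / real k)) powr (1 / real p))
      = (\<lambda>k. (\<integral>A. spectral_norm (left_product A k) ^ p \<partial>iid_space \<mu>) powr (1 / real (p * k)))"
    unfolding moment by (simp add: powr_powr mult.commute)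
  finally show ?thesis
    unfolding p_radius_def by (rule limI)
qed

text \<open>A number \<open>s\<close> strictly between the infimum and \<open>\<gamma> ^ p\<close>
  bounds the moments geometrically. Positivity of \<open>\<gamma>\<close> follows because the radius
  is a value of \<open>powr\<close>.\<close>

lemma moment_tendsto_zero:
  fixes \<mu> :: "(real^'n^'n) measure"
  assumes "bounded_law \<mu>" "p > 0" "p_radius p \<mu> < \<gamma>"
  shows "0 < \<gamma>" "(\<lambda>k. moment p \<mu> k / (\<gamma> ^ p) ^ k) \<longlonglongrightarrow> 0"
proof -
  let ?L = "INF k\<in>{1..}. moment p \<mu> k powr (1 / real k)"
  have less: "?L powr (1 / real p) < \<gamma>"
    using assms(3) unfolding p_radius_eq[OF assms(1,2)] .
  then show "0 < \<gamma>"
    by (meson order_le_less_trans powr_ge_zero)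
  have "0 \<le> ?L"
    by (intro cINF_greatest) auto
  then have "?L = (?L powr (1 / real p)) ^ p"
    using assms(2) by (cases "?L = 0") (simp_all add: powr_powr flip: powr_realpow)
  also have "\<dots> < \<gamma> ^ p"
    using less assms(2) by (intro power_strict_mono) auto
  finally obtain s where s: "?L < s" "s < \<gamma> ^ p"
    using dense by blast
  obtain C where C: "C > 0" "\<And>k. moment p \<mu> k \<le> C * s ^ k"
    using submultiplicative_geometric_bound[of "moment p \<mu>", OF moment_nonneg moment_add_le[OF assms(1)] s(1)]
    by blast
  have "s > 0"
    using s(1) \<open>0 \<le> ?L\<close> by simp
  show "(\<lambda>k. moment p \<mu> k / (\<gamma> ^ p) ^ k) \<longlonglongrightarrow> 0"
  proof (rule tendsto_sandwich[where f = "\<lambda>_. 0"])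
    show "(\<lambda>k. C * (s / \<gamma> ^ p) ^ k) \<longlonglongrightarrow> 0"
      using s(2) \<open>s > 0\<close> by (intro tendsto_mult_right_zero LIMSEQ_power_zero) simp
    show "\<forall>\<^sub>F k in sequentially. moment p \<mu> k / (\<gamma> ^ p) ^ k \<le> C * (s / \<gamma> ^ p) ^ k"
      using C(2) \<open>0 < \<gamma>\<close> by (intro always_eventually) (simp add: power_divide divide_right_mono)
    show "\<forall>\<^sub>F k in sequentially. 0 \<le> moment p \<mu> k / (\<gamma> ^ p) ^ k"
      using \<open>0 < \<gamma>\<close>
      by (intro always_eventually allI divide_nonneg_nonneg moment_nonneg) simp
  qed (rule tendsto_const)
qed

section \<open>Expected Gram matrices\<close>

lemma integral_weighted_sum:
  fixes F :: "nat \<Rightarrow> nat \<Rightarrow> 'a \<Rightarrow> real"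
  assumes "\<And>a b. a < N \<Longrightarrow> b < N \<Longrightarrow> integrable M (F a b)"
  shows "(\<integral>x. (\<Sum>a<N. \<Sum>b<N. w a b * F a b x) \<partial>M)
    = (\<Sum>a<N. \<Sum>b<N. w a b * (\<integral>x. F a b x \<partial>M))"
proof -
  have int: "integrable M (\<lambda>x. w a b * F a b x)" if "a \<in> {..<N}" "b \<in> {..<N}" for a b
    using assms that by simp
  have "(\<integral>x. (\<Sum>a<N. \<Sum>b<N. w a b * F a b x) \<partial>M) = (\<Sum>a<N. \<integral>x. (\<Sum>b<N. w a b * F a b x) \<partial>M)"
    by (intro Bochner_Integration.integral_sum Bochner_Integration.integrable_sum int)
  also have "\<dots> = (\<Sum>a<N. \<Sum>b<N. \<integral>x. w a b * F a b x \<partial>M)"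
    by (intro sum.cong[OF refl] Bochner_Integration.integral_sum int)
  finally show ?thesis by simp
qed

text \<open>Entry \<open>(i, j)\<close> of the matrix \<open>G\<^sub>k\<close> from the
  introduction, kept as a function of indices so that sums and integrals can be interchanged entry
  by entry.\<close>

definition gram :: "nat \<Rightarrow> (real^'n^'n) measure \<Rightarrow> nat \<Rightarrow> nat \<Rightarrow> nat \<Rightarrow> real" where
  "gram q \<mu> k i j = (\<integral>\<Phi>. (\<Sum>c<CARD('n) ^ q. kron_mat q \<Phi> $$ (c, i) * kron_mat q \<Phi> $$ (c, j))
    \<partial>product_law \<mu> k)"

lemma continuous_on_gram_integrand:
  assumes "i < CARD('n) ^ q" "j < CARD('n) ^ q"
  shows "continuous_on UNIV
    (\<lambda>\<Phi> :: real^'n^'n. \<Sum>c<CARD('n) ^ q. kron_mat q \<Phi> $$ (c, i) * kron_mat q \<Phi> $$ (c, j))"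
  using assms by (intro continuous_intros continuous_on_kron_mat_entry) auto

lemma gram_commute: "gram q \<mu> k i j = gram q \<mu> k j i"
  by (simp add: gram_def mult.commute)

lemma gram_0:
  fixes \<mu> :: "(real^'n^'n) measure"
  assumes "i < CARD('n) ^ q" "j < CARD('n) ^ q"
  shows "gram q \<mu> 0 i j = (if i = j then 1 else 0)"
proof -
  have "gram q \<mu> 0 i j = (\<Sum>c<CARD('n) ^ q. (1\<^sub>m (CARD('n) ^ q) :: real mat) $$ (c, i)
      * (1\<^sub>m (CARD('n) ^ q) :: real mat) $$ (c, j))"
    unfolding gram_def product_law.simps
    by (subst integral_return)
      (auto simp: kron_mat_one intro!: borel_measurable_continuous_onI
        continuous_on_gram_integrand assms)
  also have "\<dots> = (\<Sum>c<CARD('n) ^ q. if c = i then (if i = j then 1 else 0) else 0)"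
    using assms by (intro sum.cong) auto
  also have "\<dots> = (if i = j then 1 else 0)"
    using assms by simp
  finally show ?thesis .
qed

text \<open>This is \<open>G\<^sub>k\<^sub>+\<^sub>1 = E (K\<^sup>T G\<^sub>k K)\<close> in entries,
  with \<open>K\<close> the lift of \<open>A\<close>: the lift of \<open>\<Phi> ** A\<close> is the
  product of the lifts, and \<open>A\<close>, which acts first, is independent of
  \<open>\<Phi>\<close>.\<close>

lemma gram_Suc:
  fixes \<mu> :: "(real^'n^'n) measure"
  assumes "bounded_law \<mu>" and ij: "i < CARD('n) ^ q" "j < CARD('n) ^ q"
  shows "gram q \<mu> (Suc k) i j = (\<Sum>a<CARD('n) ^ q. \<Sum>b<CARD('n) ^ q.
    (\<integral>A. kron_mat q A $$ (a, i) * kron_mat q A $$ (b, j) \<partial>\<mu>) * gram q \<mu> k a b)"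
proof -
  let ?N = "CARD('n) ^ q"
  let ?K = "\<lambda>A :: real^'n^'n. kron_mat q A"
  let ?f = "\<lambda>\<Phi>. \<Sum>c<?N. ?K \<Phi> $$ (c, i) * ?K \<Phi> $$ (c, j)"
  note law = bounded_law_product_law[OF assms(1)]
  have expand: "?f (\<Phi> ** A) = (\<Sum>a<?N. \<Sum>b<?N. (?K A $$ (a, i) * ?K A $$ (b, j))
      * (\<Sum>c<?N. ?K \<Phi> $$ (c, a) * ?K \<Phi> $$ (c, b)))" for \<Phi> A :: "real^'n^'n"
  proof -
    have entry: "?K (\<Phi> ** A) $$ (c, l) = (\<Sum>a<?N. ?K \<Phi> $$ (c, a) * ?K A $$ (a, l))"
      if "c < ?N" "l < ?N" for c l
      unfolding kron_mat_mult
      using that kron_mat_carrier[of q \<Phi>] kron_mat_carrier[of q A]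
      by (simp add: scalar_prod_def atLeast0LessThan)
    have "?f (\<Phi> ** A) = (\<Sum>c<?N. \<Sum>a<?N. \<Sum>b<?N.
        (?K \<Phi> $$ (c, a) * ?K A $$ (a, i)) * (?K \<Phi> $$ (c, b) * ?K A $$ (b, j)))"
      using ij by (simp add: entry sum_product)
    \<comment> \<open>Moving the sum over \<open>c\<close> innermost isolates the Gram entry of
      \<open>\<Phi>\<close>.\<close>
    also have "\<dots> = (\<Sum>a<?N. \<Sum>c<?N. \<Sum>b<?N.
        (?K \<Phi> $$ (c, a) * ?K A $$ (a, i)) * (?K \<Phi> $$ (c, b) * ?K A $$ (b, j)))"
      by (rule sum.swap)
    also have "\<dots> = (\<Sum>a<?N. \<Sum>b<?N. \<Sum>c<?N.
        (?K \<Phi> $$ (c, a) * ?K A $$ (a, i)) * (?K \<Phi> $$ (c, b) * ?K A $$ (b, j)))"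
      by (intro sum.cong refl sum.swap)
    also have "\<dots> = (\<Sum>a<?N. \<Sum>b<?N. (?K A $$ (a, i) * ?K A $$ (b, j))
        * (\<Sum>c<?N. ?K \<Phi> $$ (c, a) * ?K \<Phi> $$ (c, b)))"
      unfolding sum_distrib_left by (intro sum.cong refl) (simp add: mult_ac)
    finally show ?thesis .
  qed
  have int: "integrable (product_law \<mu> k) (\<lambda>\<Phi>. \<Sum>c<?N. ?K \<Phi> $$ (c, a) * ?K \<Phi> $$ (c, b))"
    if "a < ?N" "b < ?N" for a b
    using that by (intro integrable_bounded_law[OF law] continuous_on_gram_integrand)
  have int': "integrable \<mu> (\<lambda>A. ?K A $$ (a, i) * ?K A $$ (b, j))" if "a < ?N" "b < ?N" for a b
    using that ij
    by (intro integrable_bounded_law[OF assms(1)] continuous_intros continuous_on_kron_mat_entry)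
  have "gram q \<mu> (Suc k) i j = (\<integral>A. \<integral>\<Phi>. ?f (\<Phi> ** A) \<partial>product_law \<mu> k \<partial>\<mu>)"
    unfolding gram_def product_law_Suc[OF assms(1)]
    by (rule integral_mult_law(1)[OF assms(1) law continuous_on_gram_integrand[OF ij]])
  also have "\<dots> = (\<integral>A. (\<Sum>a<?N. \<Sum>b<?N. (?K A $$ (a, i) * ?K A $$ (b, j)) * gram q \<mu> k a b) \<partial>\<mu>)"
    unfolding expand gram_def
    by (intro Bochner_Integration.integral_cong[OF refl] integral_weighted_sum int)
  also have "\<dots> = (\<Sum>a<?N. \<Sum>b<?N. (\<integral>A. ?K A $$ (a, i) * ?K A $$ (b, j) \<partial>\<mu>) * gram q \<mu> k a b)"
    using integral_weighted_sum[where w = "gram q \<mu> k", OF int'] by (simp add: mult.commute)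
  finally show ?thesis .
qed

text \<open>Each summand is a product of two entries bounded by the \<open>q\<close>th power of the
  spectral norm, whence the moment of order \<open>2 * q\<close>.\<close>

lemma abs_gram_le:
  fixes \<mu> :: "(real^'n^'n) measure"
  assumes "bounded_law \<mu>" "i < CARD('n) ^ q" "j < CARD('n) ^ q"
  shows "\<bar>gram q \<mu> k i j\<bar> \<le> CARD('n) ^ q * moment (2 * q) \<mu> k"
proof -
  let ?N = "CARD('n) ^ q"
  let ?f = "\<lambda>\<Phi> :: real^'n^'n. \<Sum>c<?N. kron_mat q \<Phi> $$ (c, i) * kron_mat q \<Phi> $$ (c, j)"
  note law = bounded_law_product_law[OF assms(1)]
  have "\<bar>?f \<Phi>\<bar> \<le> real ?N * spectral_norm \<Phi> ^ (2 * q)" for \<Phi> :: "real^'n^'n"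
  proof -
    have "\<bar>?f \<Phi>\<bar> \<le> (\<Sum>c<?N. \<bar>kron_mat q \<Phi> $$ (c, i) * kron_mat q \<Phi> $$ (c, j)\<bar>)"
      by (rule sum_abs)
    also have "\<dots> \<le> (\<Sum>c<?N. spectral_norm \<Phi> ^ q * spectral_norm \<Phi> ^ q)"
      unfolding abs_mult using assms(2,3)
      by (intro sum_mono mult_mono abs_kron_mat_entry_le) (auto simp: spectral_norm_nonneg)
    finally show ?thesis
      by (simp add: mult_2 power_add)
  qed
  then have "(\<integral>\<Phi>. \<bar>?f \<Phi>\<bar> \<partial>product_law \<mu> k)
      \<le> (\<integral>\<Phi>. real ?N * spectral_norm \<Phi> ^ (2 * q) \<partial>product_law \<mu> k)"
    using assms
    by (intro integral_mono integrable_bounded_law[OF law] continuous_on_mult continuous_on_const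
        continuous_on_rabs continuous_on_gram_integrand continuous_on_spectral_norm_power) auto
  then show ?thesis
    unfolding gram_def moment_def by (intro order_trans[OF integral_abs_bound]) simp
qed

text \<open>Pointwise the form is the squared length of the lifted matrix applied to
  \<open>v\<close>; integration preserves the sign.\<close>

lemma gram_form_nonneg:
  fixes \<mu> :: "(real^'n^'n) measure"
  assumes "bounded_law \<mu>"
  shows "0 \<le> (\<Sum>i<CARD('n) ^ q. \<Sum>j<CARD('n) ^ q. v i * v j * gram q \<mu> k i j)"
proof -
  let ?N = "CARD('n) ^ q"
  let ?K = "\<lambda>A :: real^'n^'n. kron_mat q A"
  note law = bounded_law_product_law[OF assms(1)]
  have int: "integrable (product_law \<mu> k) (\<lambda>\<Phi>. \<Sum>c<?N. ?K \<Phi> $$ (c, a) * ?K \<Phi> $$ (c, b))"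
    if "a < ?N" "b < ?N" for a b
    using that by (intro integrable_bounded_law[OF law] continuous_on_gram_integrand)
  have "(\<Sum>i<?N. \<Sum>j<?N. v i * v j * (\<Sum>c<?N. ?K \<Phi> $$ (c, i) * ?K \<Phi> $$ (c, j)))
      = (\<Sum>c<?N. (\<Sum>i<?N. v i * ?K \<Phi> $$ (c, i))\<^sup>2)" for \<Phi>
  proof -
    have "(\<Sum>i<?N. \<Sum>j<?N. v i * v j * (\<Sum>c<?N. ?K \<Phi> $$ (c, i) * ?K \<Phi> $$ (c, j)))
        = (\<Sum>i<?N. \<Sum>c<?N. \<Sum>j<?N. (v i * ?K \<Phi> $$ (c, i)) * (v j * ?K \<Phi> $$ (c, j)))"
      unfolding sum_distrib_left
      by (rule sum.cong[OF refl], subst sum.swap, intro sum.cong refl) (simp add: mult_ac)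
    also have "\<dots> = (\<Sum>c<?N. \<Sum>i<?N. \<Sum>j<?N. (v i * ?K \<Phi> $$ (c, i)) * (v j * ?K \<Phi> $$ (c, j)))"
      by (rule sum.swap)
    finally show ?thesis
      by (simp add: power2_eq_square sum_product)
  qed
  then have "0 \<le> (\<integral>\<Phi>. (\<Sum>i<?N. \<Sum>j<?N. v i * v j * (\<Sum>c<?N. ?K \<Phi> $$ (c, i) * ?K \<Phi> $$ (c, j)))
      \<partial>product_law \<mu> k)"
    by (intro Bochner_Integration.integral_nonneg) (simp add: sum_nonneg)
  also have "\<dots> = (\<Sum>i<?N. \<Sum>j<?N. v i * v j * gram q \<mu> k i j)"
    unfolding gram_def by (rule integral_weighted_sum[OF int])
  finally show ?thesis .
qed

text \<open>The inequality \<open>2 * \<bar>x * y\<bar> \<le> x\<^sup>2 + y\<^sup>2\<close> compares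
  the form with the identity. The constant is crude, but being proportional to \<open>B\<close> is
  enough, since the moments decay after scaling.\<close>

lemma bilinear_sum_le:
  fixes v :: "nat \<Rightarrow> real"
  assumes "\<And>i j. i < N \<Longrightarrow> j < N \<Longrightarrow> \<bar>g i j\<bar> \<le> B"
  shows "(\<Sum>i<N. \<Sum>j<N. v i * v j * g i j) \<le> B * real N * (\<Sum>i<N. (v i)\<^sup>2)"
proof -
  have "(\<Sum>i<N. \<Sum>j<N. v i * v j * g i j) \<le> (\<Sum>i<N. \<Sum>j<N. B * (((v i)\<^sup>2 + (v j)\<^sup>2) / 2))"
  proof (intro sum_mono)
    fix i j assume ij: "i \<in> {..<N}" "j \<in> {..<N}"
    have "v i * v j * g i j \<le> \<bar>v i * v j\<bar> * \<bar>g i j\<bar>"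
      by (metis abs_ge_self abs_mult)
    also have "\<dots> \<le> (((v i)\<^sup>2 + (v j)\<^sup>2) / 2) * B"
    proof (rule mult_mono)
      have "0 \<le> (\<bar>v i\<bar> - \<bar>v j\<bar>)\<^sup>2" by simp
      then show "\<bar>v i * v j\<bar> \<le> ((v i)\<^sup>2 + (v j)\<^sup>2) / 2"
        by (simp add: power2_diff abs_mult)
    qed (use ij assms in auto)
    finally show "v i * v j * g i j \<le> B * (((v i)\<^sup>2 + (v j)\<^sup>2) / 2)"
      by (simp add: mult.commute)
  qed
  also have "\<dots> = B * real N * (\<Sum>i<N. (v i)\<^sup>2)"
    by (simp add: sum.distrib sum_divide_distrib[symmetric] sum_distrib_left[symmetric]
        add_divide_distrib)
  finally show ?thesis .
qed

section \<open>Construction of a solution\<close>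

lemma lmi_solution_exists:
  fixes \<mu> :: "(real^'n^'n) measure"
  assumes "bounded_law \<mu>" "p > 0" "p = 2 * q" "p_radius p \<mu> < \<gamma>"
  shows "\<exists>H. positive_definite (CARD('n) ^ q) H \<and> lmi_solution \<mu> p q \<gamma> H"
proof -
  let ?N = "CARD('n) ^ q"
  let ?K = "\<lambda>A :: real^'n^'n. kron_mat q A"
  let ?G = "gram q \<mu>"
  have \<gamma>: "0 < \<gamma>"
    using moment_tendsto_zero(1)[OF assms(1,2,4)] .
  \<comment> \<open>The weight that makes the series telescope: multiplying by
    \<open>\<gamma> ^ p\<close> lowers the power of \<open>c\<close> by one.\<close>
  define c where "c = 1 / \<gamma> ^ p"
  have c: "c > 0" "\<gamma> ^ p * c = 1"
    using \<gamma> by (simp_all add: c_def)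
  have "(\<lambda>k. real ?N * real ?N * (moment p \<mu> k / (\<gamma> ^ p) ^ k)) \<longlonglongrightarrow> 0"
    by (intro tendsto_mult_right_zero moment_tendsto_zero(2)[OF assms(1,2,4)])
  then have "\<forall>\<^sub>F k in sequentially. real ?N * real ?N * (moment p \<mu> k / (\<gamma> ^ p) ^ k) < 1"
    by (rule order_tendstoD) simp
  then have "\<forall>\<^sub>F k in sequentially. k \<ge> 1 \<and> real ?N * real ?N * (moment p \<mu> k / (\<gamma> ^ p) ^ k) < 1"
    using eventually_ge_at_top[of 1] by eventually_elim simp
  \<comment> \<open>One factor \<open>real ?N\<close> pays for \<open>abs_gram_le\<close>, the other
    for \<open>bilinear_sum_le\<close>. The condition \<open>m \<ge> 1\<close> puts the term
    \<open>k = 0\<close> into the sum that defines \<open>H\<close>.\<close>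
  then obtain m where m: "m \<ge> 1" "real ?N * real ?N * (moment p \<mu> m / (\<gamma> ^ p) ^ m) < 1"
    using eventually_happens by force
  define h where "h i j = (\<Sum>k<m. c ^ k * ?G k i j)" for i j
  define H where "H = Matrix.mat ?N ?N (\<lambda>(i, j). h i j)"
  have H_entry: "H $$ (i, j) = h i j" if "i < ?N" "j < ?N" for i j
    using that by (simp add: H_def)
  define Q where "Q k v = (\<Sum>i<?N. \<Sum>j<?N. vec_index v i * vec_index v j * ?G k i j)"
    for k and v :: "real Matrix.vec"
  have H: "H \<in> carrier_mat ?N ?N" "transpose_mat H = H"
    unfolding H_def h_def by (auto intro!: eq_matI simp: gram_commute)
  have Q0: "Q 0 v = (\<Sum>i<?N. (vec_index v i)\<^sup>2)" for v
  proof -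
    have "Q 0 v = (\<Sum>i<?N. \<Sum>j<?N. if j = i then (vec_index v i)\<^sup>2 else 0)"
      unfolding Q_def by (intro sum.cong refl) (auto simp: gram_0 power2_eq_square)
    then show ?thesis by simp
  qed
  have Q_nonneg: "0 \<le> Q k v" for k v
    unfolding Q_def by (rule gram_form_nonneg[OF assms(1)])
  have "positive_definite ?N H"
    unfolding positive_definite_def
  proof (intro conjI H ballI impI)
    fix v :: "real Matrix.vec" assume v: "v \<in> carrier_vec ?N" "v \<noteq> 0\<^sub>v ?N"
    then obtain i where i: "i < ?N" "vec_index v i \<noteq> 0"
      by (metis carrier_vecD eq_vecI index_zero_vec)
    have "0 < Q 0 v"
      unfolding Q0 by (rule sum_pos2[of _ i]) (use i in auto)
    \<comment> \<open>The term \<open>k = 0\<close> is the identity matrix and already gives strict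
      positivity; the other terms are nonnegative.\<close>
    also have "Q 0 v \<le> (\<Sum>k<m. c ^ k * Q k v)"
      using member_le_sum[of 0 "{..<m}" "\<lambda>k. c ^ k * Q k v"] m(1) c(1) Q_nonneg by simp
    also have "\<dots> = (\<Sum>i<?N. \<Sum>j<?N. vec_index v i * vec_index v j * h i j)"
      unfolding Q_def h_def sum_distrib_left
      by (subst sum.swap, rule sum.cong[OF refl], subst sum.swap, intro sum.cong refl)
        (simp add: mult_ac)
    also have "\<dots> = scalar_prod v (H *\<^sub>v v)"
      by (subst scalar_prod_mult_mat_vec[OF H(1) v(1)]) (simp add: H_def)
    finally show "0 < scalar_prod v (H *\<^sub>v v)" .
  qed
  moreover have "lmi_solution \<mu> p q \<gamma> H"
  proof -
    define L where "L = expectation_mat ?N \<mu> (\<lambda>A. transpose_mat (?K A) * H * ?K A) - \<gamma> ^ p \<cdot>\<^sub>m H"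
    have L: "L \<in> carrier_mat ?N ?N"
      using H(1) by (auto simp: L_def expectation_mat_def)
    have int: "integrable \<mu> (\<lambda>A. ?K A $$ (a, i) * ?K A $$ (b, j))"
      if "a < ?N" "b < ?N" "i < ?N" "j < ?N" for a b i j
      using that
      by (intro integrable_bounded_law[OF assms(1)] continuous_intros continuous_on_kron_mat_entry)
    \<comment> \<open>By \<open>gram_Suc\<close> the expectation shifts the index of each Gram
      matrix by one, so only the two ends of the sum survive.\<close>
    have entry: "L $$ (i, j) = \<gamma> ^ p * (c ^ m * ?G m i j - ?G 0 i j)" if ij: "i < ?N" "j < ?N" for i j
    proof -
      have "(\<integral>A. (transpose_mat (?K A) * H * ?K A) $$ (i, j) \<partial>\<mu>)
          = (\<integral>A. (\<Sum>a<?N. \<Sum>b<?N. ?K A $$ (a, i) * ?K A $$ (b, j) * h a b) \<partial>\<mu>)"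
        using ij
        by (simp add: transpose_mult_mult_entry[OF kron_mat_carrier H(1)] H_entry del: index_mult_mat)
      also have "\<dots> = (\<Sum>a<?N. \<Sum>b<?N. (\<integral>A. ?K A $$ (a, i) * ?K A $$ (b, j) \<partial>\<mu>) * h a b)"
        using integral_weighted_sum[where w = h, OF int[OF _ _ ij]] by (simp add: mult.commute)
      also have "\<dots> = (\<Sum>k<m. c ^ k * (\<Sum>a<?N. \<Sum>b<?N.
          (\<integral>A. ?K A $$ (a, i) * ?K A $$ (b, j) \<partial>\<mu>) * ?G k a b))"
        unfolding h_def sum_distrib_left
        by (rule sym, subst sum.swap, rule sum.cong[OF refl], subst sum.swap, intro sum.cong refl)
          (simp add: mult_ac)
      also have "\<dots> = (\<Sum>k<m. c ^ k * ?G (Suc k) i j)"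
        using ij by (simp add: gram_Suc[OF assms(1)])
      also have "\<dots> = \<gamma> ^ p * (\<Sum>k<m. c ^ Suc k * ?G (Suc k) i j)"
        using c(2) by (simp add: sum_distrib_left mult.assoc[symmetric])
      finally have "L $$ (i, j)
          = \<gamma> ^ p * ((\<Sum>k<m. c ^ Suc k * ?G (Suc k) i j) - (\<Sum>k<m. c ^ k * ?G k i j))"
        using ij by (simp add: L_def expectation_mat_def H_def h_def right_diff_distrib)
      also have "\<dots> = \<gamma> ^ p * (c ^ m * ?G m i j - ?G 0 i j)"
        using sum_lessThan_telescope[of "\<lambda>k. c ^ k * ?G k i j" m]
        by (simp add: sum_subtractf)
      finally show ?thesis .
    qed
    have "negative_semidefinite ?N L"
      unfolding negative_semidefinite_def
    proof (intro conjI L ballI)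
      show "transpose_mat L = L"
        using L by (intro eq_matI) (auto simp: entry gram_commute)
      fix v :: "real Matrix.vec" assume v: "v \<in> carrier_vec ?N"
      have "scalar_prod v (L *\<^sub>v v) = (\<Sum>i<?N. \<Sum>j<?N. vec_index v i * vec_index v j
          * (\<gamma> ^ p * (c ^ m * ?G m i j - ?G 0 i j)))"
        by (subst scalar_prod_mult_mat_vec[OF L v]) (simp add: entry)
      also have "\<dots> = \<gamma> ^ p * (c ^ m * Q m v - Q 0 v)"
        unfolding Q_def by (simp add: sum_distrib_left sum_subtractf algebra_simps)
      also have "\<dots> \<le> 0"
      proof -
        \<comment> \<open>The choice of \<open>m\<close> makes the scaled form of
          \<open>G\<^sub>m\<close> at most the squared length \<open>Q 0 v\<close>.\<close>
        have "Q m v \<le> real ?N * moment p \<mu> m * real ?N * (\<Sum>i<?N. (vec_index v i)\<^sup>2)"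
          unfolding Q_def assms(3) by (intro bilinear_sum_le abs_gram_le assms(1))
        then have "Q m v \<le> real ?N * moment p \<mu> m * real ?N * Q 0 v"
          by (simp add: Q0)
        then have "c ^ m * Q m v \<le> c ^ m * (real ?N * moment p \<mu> m * real ?N * Q 0 v)"
          using c(1) by (intro mult_left_mono) auto
        also have "\<dots> = real ?N * real ?N * (moment p \<mu> m / (\<gamma> ^ p) ^ m) * Q 0 v"
          by (simp add: c_def power_divide mult_ac)
        also have "\<dots> \<le> 1 * Q 0 v"
          using m(2) Q_nonneg[of 0 v] by (intro mult_right_mono) auto
        finally show ?thesis
          using \<gamma> by (simp add: mult_nonneg_nonpos)
      qed
      finally show "scalar_prod v (L *\<^sub>v v) \<le> 0" .
    qed
    then show ?thesis
      by (simp add: lmi_solution_def L_def kron_mat_def)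
  qed
  ultimately show ?thesis by blast
qed

section \<open>From the matrix inequality to the Lyapunov function\<close>

text \<open>Minimum and maximum on the compact unit sphere serve as constants; homogeneity carries
  the bounds to all other points.\<close>

lemma homogeneous_positive_bounds:
  fixes f :: "'a::euclidean_space \<Rightarrow> real"
  assumes cont: "continuous_on UNIV f" and "p > 0"
    and hom: "\<And>c x. f (c *\<^sub>R x) = c ^ p * f x" and pos: "\<And>x. x \<noteq> 0 \<Longrightarrow> f x > 0"
  obtains C\<^sub>1 C\<^sub>2 where "C\<^sub>1 > 0" "C\<^sub>2 > 0" "\<And>x. C\<^sub>1 * norm x ^ p \<le> f x \<and> f x \<le> C\<^sub>2 * norm x ^ p"
proof -
  have sph: "compact (sphere (0 :: 'a) 1)" "sphere (0 :: 'a) 1 \<noteq> {}"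
    by simp_all
  have cont': "continuous_on (sphere 0 1) f"
    using cont by (rule continuous_on_subset) simp
  obtain u where u: "norm u = 1" "\<And>x. norm x = 1 \<Longrightarrow> f u \<le> f x"
    using continuous_attains_inf[OF sph cont'] by auto
  obtain w where w: "norm w = 1" "\<And>x. norm x = 1 \<Longrightarrow> f x \<le> f w"
    using continuous_attains_sup[OF sph cont'] by auto
  have "f u * norm x ^ p \<le> f x \<and> f x \<le> f w * norm x ^ p" for x
  proof (cases "x = 0")
    \<comment> \<open>With scaling factor 0 and \<open>p > 0\<close>, homogeneity forces the value 0
      at the origin.\<close>
    case True
    then show ?thesis
      using hom[of 0 x] \<open>p > 0\<close> by (simp add: zero_power)
  next
    case False
    define y where "y = (1 / norm x) *\<^sub>R x"
    have y: "norm y = 1" "x = norm x *\<^sub>R y"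
      using False by (simp_all add: y_def)
    have "f x = norm x ^ p * f y"
      using hom[of "norm x" y] y(2) by simp
    then show ?thesis
      using u(2)[OF y(1)] w(2)[OF y(1)] by (simp add: mult.commute[of _ "f y"] mult_right_mono)
  qed
  moreover have "f u > 0" "f w > 0"
    using u(1) w(1) by (auto intro!: pos)
  ultimately show ?thesis using that by blast
qed

lemma lmi_solution_stochastic_lyapunov:
  fixes \<mu> :: "(real^'n^'n) measure"
  assumes "bounded_law \<mu>" "p > 0" "p = 2 * q" "0 \<le> \<gamma>" "\<gamma> < 1"
    and pd: "positive_definite (CARD('n) ^ q) H" and lmi: "lmi_solution \<mu> p q \<gamma> H"
  shows "stochastic_lyapunov \<mu> p \<gamma> (kronecker_form q H)"
proof -
  let ?N = "CARD('n) ^ q"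
  let ?K = "\<lambda>A :: real^'n^'n. kron_mat q A"
  let ?V = "kronecker_form q H :: real^'n \<Rightarrow> real"
  let ?y = "\<lambda>x :: real^'n. kron_vec q x"
  have H: "H \<in> carrier_mat ?N ?N"
    using pd by (simp add: positive_definite_def)
  note V = kronecker_form_eq[OF H]
  have V_sum: "?V x = (\<Sum>i<?N. \<Sum>j<?N. vec_index (?y x) i * vec_index (?y x) j * H $$ (i, j))" for x
    unfolding V by (rule scalar_prod_mult_mat_vec[OF H kron_vec_carrier])
  have cont: "continuous_on UNIV ?V"
    unfolding V_sum by (intro continuous_intros continuous_on_kron_vec_entry) auto
  have hom: "?V (c *\<^sub>R x) = c ^ p * ?V x" for c x
  proof -
    have "vec_index (?y (c *\<^sub>R x)) i = c ^ q * vec_index (?y x) i" if "i < ?N" for i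
      using that kron_vec_carrier[of q x] by (simp add: kron_vec_scaleR)
    moreover have "c ^ p = c ^ q * c ^ q"
      by (simp add: assms(3) mult_2 power_add)
    ultimately show ?thesis
      unfolding V_sum sum_distrib_left by (intro sum.cong refl) (simp add: mult_ac)
  qed
  have pos: "?V x > 0" if "x \<noteq> 0" for x
  proof -
    have "?y x \<noteq> 0\<^sub>v ?N"
    proof
      assume "?y x = 0\<^sub>v ?N"
      then show False
        using scalar_prod_kron_vec[of q x] that by simp
    qed
    then show ?thesis
      using pd kron_vec_carrier unfolding V positive_definite_def by blast
  qed
  obtain C\<^sub>1 C\<^sub>2 where C: "C\<^sub>1 > 0" "C\<^sub>2 > 0"
    "\<And>x. C\<^sub>1 * norm x ^ p \<le> ?V x \<and> ?V x \<le> C\<^sub>2 * norm x ^ p"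
    using homogeneous_positive_bounds[OF cont assms(2) hom pos] by blast
  have int: "integrable \<mu> (\<lambda>A. ?V (A *v x))" for x
    by (intro integrable_bounded_law[OF assms(1)] continuous_on_compose2[OF cont] continuous_intros)
      auto
  have growth: "(\<integral>A. ?V (A *v x) \<partial>\<mu>) \<le> \<gamma> ^ p * ?V x" for x
  proof -
    let ?B = "\<lambda>A. transpose_mat (?K A) * H * ?K A"
    let ?E = "expectation_mat ?N \<mu> ?B"
    have B: "?B A \<in> carrier_mat ?N ?N" for A
      using H kron_mat_carrier[of q A] by auto
    have E: "?E \<in> carrier_mat ?N ?N"
      by (simp add: expectation_mat_def)
    have intB: "integrable \<mu> (\<lambda>A. ?B A $$ (i, j))" if "i < ?N" "j < ?N" for i j
      using that
      by (simp only: transpose_mult_mult_entry[OF kron_mat_carrier H])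
        (intro integrable_bounded_law[OF assms(1)] continuous_intros continuous_on_kron_mat_entry;
          simp)
    \<comment> \<open>Lifting the next state turns the integrand into a quadratic form in the fixed
      vector \<open>?y x\<close>, so the expectation falls on the matrix entries alone.\<close>
    have "(\<integral>A. ?V (A *v x) \<partial>\<mu>)
        = (\<integral>A. (\<Sum>i<?N. \<Sum>j<?N. vec_index (?y x) i * vec_index (?y x) j * ?B A $$ (i, j)) \<partial>\<mu>)"
      unfolding V kron_vec_mult scalar_prod_congruence[OF kron_mat_carrier H kron_vec_carrier, symmetric]
        scalar_prod_mult_mat_vec[OF B kron_vec_carrier] ..
    also have "\<dots> = (\<Sum>i<?N. \<Sum>j<?N. vec_index (?y x) i * vec_index (?y x) j
        * (\<integral>A. ?B A $$ (i, j) \<partial>\<mu>))"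
      by (rule integral_weighted_sum[OF intB])
    also have "\<dots> = scalar_prod (?y x) (?E *\<^sub>v ?y x)"
      unfolding scalar_prod_mult_mat_vec[OF E kron_vec_carrier]
      by (intro sum.cong refl) (simp add: expectation_mat_def del: index_mult_mat)
    finally have *: "(\<integral>A. ?V (A *v x) \<partial>\<mu>) = scalar_prod (?y x) (?E *\<^sub>v ?y x)" .
    \<comment> \<open>The matrix inequality is tested at the lift of \<open>x\<close>.\<close>
    have "0 \<ge> scalar_prod (?y x) ((?E - \<gamma> ^ p \<cdot>\<^sub>m H) *\<^sub>v ?y x)"
      using lmi kron_vec_carrier[of q x]
      by (simp add: lmi_solution_def negative_semidefinite_def kron_mat_def)
    also have "scalar_prod (?y x) ((?E - \<gamma> ^ p \<cdot>\<^sub>m H) *\<^sub>v ?y x)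
        = scalar_prod (?y x) (?E *\<^sub>v ?y x) - \<gamma> ^ p * ?V x"
    proof -
      have "?E - \<gamma> ^ p \<cdot>\<^sub>m H \<in> carrier_mat ?N ?N"
        using E H by auto
      then show ?thesis
        unfolding V scalar_prod_mult_mat_vec[OF H kron_vec_carrier]
          scalar_prod_mult_mat_vec[OF E kron_vec_carrier]
        using E H by (subst scalar_prod_mult_mat_vec[OF _ kron_vec_carrier])
          (simp_all add: right_diff_distrib sum_subtractf sum_distrib_left mult_ac)
    qed
    finally show ?thesis
      using * by simp
  qed
  show ?thesis
    unfolding stochastic_lyapunov_def using assms(4,5) C int growth by blast
qed

text \<open>Solvability belongs to the claim, as otherwise the universally quantified half could
  hold vacuously.\<close>

theorem theorem5p7:
  fixes \<mu> :: "(real^'n^'n) measure" and p q :: nat and \<gamma> :: real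
  assumes "matrix_distribution \<mu>"
    and "bounded (msupport \<mu>)"
    and "p > 0"
    and "mean_stable p \<mu>"
    and "even p"
    and "q = p div 2"
    and "p_radius p \<mu> < \<gamma>" and "\<gamma> < 1"
  shows "(\<exists>H. positive_definite (CARD('n) ^ q) H \<and> lmi_solution \<mu> p q \<gamma> H) \<and>
    (\<forall>H. positive_definite (CARD('n) ^ q) H \<and> lmi_solution \<mu> p q \<gamma> H \<longrightarrow>
      stochastic_lyapunov \<mu> p \<gamma> (kronecker_form q H))"
proof -
  have law: "bounded_law \<mu>"
    using assms(1,2) by (auto simp: matrix_distribution_def intro: bounded_law_if_bounded_msupport)
  have pq: "p = 2 * q"
    using assms(5,6) by simp
  \<comment> \<open>A growth rate must be nonnegative; this follows from \<open>\<gamma>\<close>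
    lying above the p-radius.\<close>
  have "0 \<le> \<gamma>"
    using moment_tendsto_zero(1)[OF law assms(3,7)] by simp
  then show ?thesis
    using lmi_solution_exists[OF law assms(3) pq assms(7)]
      lmi_solution_stochastic_lyapunov[OF law assms(3) pq _ assms(8)] by blast
qed

end
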